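(* Let $D=\{z=x+iy\in\mathbb{C}:|x-\tfrac{\pi}{2}|+|y|<\tfrac{\pi}{2}\}$. Then $A^2(D)\subset X:=W^{-1,2}(0,\pi)$.
   Context: $A^2(D)$ is the space of holomorphic functions $f$ on $D$ with $\int_D|f(x+iy)|^2\,dx\,dy<+\infty$. $W^{-1,2}(0,\pi)$ is the dual of the Sobolev space $W^{1,2}_0(0,\pi)$. A function in $A^2(D)$ is identified with its restriction to the interval $(0,\pi)\subset D$, regarded as a distribution on $(0,\pi)$; the inclusion means that this distribution belongs to $W^{-1,2}(0,\pi)$. *)

theory Defs
  imports "HOL-Complex_Analysis.Complex_Analysis"
begin

definition L2_space :: "'a::euclidean_space set \<Rightarrow> ('a \<Rightarrow> complex) set" where
  "L2_space S = {u \<in> borel_measurable (lebesgue_on S).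
                   integrable (lebesgue_on S) (\<lambda>x. (cmod (u x))\<^sup>2)}"

definition L2_norm :: "'a::euclidean_space set \<Rightarrow> ('a \<Rightarrow> complex) \<Rightarrow> real" where
  "L2_norm S u = sqrt (LINT x|lebesgue_on S. (cmod (u x))\<^sup>2)"

definition Bergman_space :: "complex set \<Rightarrow> (complex \<Rightarrow> complex) set" where
  "Bergman_space D = {f. f holomorphic_on D \<and>
                         integrable (lebesgue_on D) (\<lambda>z. (cmod (f z))\<^sup>2)}"

definition vderiv :: "(real \<Rightarrow> complex) \<Rightarrow> real \<Rightarrow> complex" where
  "vderiv g = (\<lambda>x. vector_derivative g (at x))"

text \<open>Test functions on an open set \<open>S\<close> are represented by their extension by zero to
  the whole line.\<close>

definition test_functions :: "real set \<Rightarrow> (real \<Rightarrow> complex) set" where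
  "test_functions S = {\<phi>. (\<forall>n x. (vderiv ^^ n) \<phi> differentiable (at x)) \<and>
                          (\<exists>K. compact K \<and> K \<subseteq> S \<and> (\<forall>x. x \<notin> K \<longrightarrow> \<phi> x = 0))}"

text \<open>Functionals on a space of functions are total maps whose values outside that space are
  irrelevant. Continuity of a distribution is the usual seminorm estimate on each compact
  set.\<close>

definition distribution_on :: "real set \<Rightarrow> ((real \<Rightarrow> complex) \<Rightarrow> complex) \<Rightarrow> bool" where
  "distribution_on S T \<longleftrightarrow>
     (\<forall>\<phi>\<in>test_functions S. \<forall>\<psi>\<in>test_functions S. T (\<lambda>x. \<phi> x + \<psi> x) = T \<phi> + T \<psi>) \<and>
     (\<forall>c. \<forall>\<phi>\<in>test_functions S. T (\<lambda>x. c * \<phi> x) = c * T \<phi>) \<and>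
     (\<forall>K. compact K \<and> K \<subseteq> S \<longrightarrow>
        (\<exists>N C. \<forall>\<phi>\<in>test_functions S. (\<forall>x. x \<notin> K \<longrightarrow> \<phi> x = 0) \<longrightarrow>
           cmod (T \<phi>) \<le> C * (\<Sum>n\<le>N. SUP x. cmod ((vderiv ^^ n) \<phi> x))))"

definition regular_distribution ::
    "real set \<Rightarrow> (real \<Rightarrow> complex) \<Rightarrow> (real \<Rightarrow> complex) \<Rightarrow> complex" where
  "regular_distribution S g = (\<lambda>\<phi>. LINT x|lebesgue_on S. g x * \<phi> x)"

definition has_weak_derivative ::
    "real set \<Rightarrow> (real \<Rightarrow> complex) \<Rightarrow> (real \<Rightarrow> complex) \<Rightarrow> bool" where
  "has_weak_derivative S u v \<longleftrightarrow>
     (\<forall>\<phi>\<in>test_functions S.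
        (LINT x|lebesgue_on S. u x * vderiv \<phi> x) = - (LINT x|lebesgue_on S. v x * \<phi> x))"

text \<open>Functions are not quotiented by almost-everywhere equality; \<open>Sobolev_norm\<close> is thus a
  seminorm vanishing exactly on null functions.\<close>

definition Sobolev_space :: "real set \<Rightarrow> (real \<Rightarrow> complex) set" where
  "Sobolev_space S = {u \<in> L2_space S. \<exists>v\<in>L2_space S. has_weak_derivative S u v}"

text \<open>The weak derivative is unique only up to null sets; the choice does not affect the
  norm.\<close>

definition weak_derivative :: "real set \<Rightarrow> (real \<Rightarrow> complex) \<Rightarrow> real \<Rightarrow> complex" where
  "weak_derivative S u = (SOME v. v \<in> L2_space S \<and> has_weak_derivative S u v)"

definition Sobolev_norm :: "real set \<Rightarrow> (real \<Rightarrow> complex) \<Rightarrow> real" where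
  "Sobolev_norm S u = sqrt ((L2_norm S u)\<^sup>2 + (L2_norm S (weak_derivative S u))\<^sup>2)"

definition Sobolev_space_0 :: "real set \<Rightarrow> (real \<Rightarrow> complex) set" where
  "Sobolev_space_0 S = {u \<in> Sobolev_space S.
     \<exists>\<phi>. (\<forall>n::nat. \<phi> n \<in> test_functions S) \<and>
         (\<lambda>n. Sobolev_norm S (\<lambda>x. \<phi> n x - u x)) \<longlonglongrightarrow> 0}"

text \<open>The bound forces a functional to agree on almost-everywhere equal functions.\<close>

definition Sobolev_dual :: "real set \<Rightarrow> ((real \<Rightarrow> complex) \<Rightarrow> complex) set" where
  "Sobolev_dual S = {l.
     (\<forall>u\<in>Sobolev_space_0 S. \<forall>v\<in>Sobolev_space_0 S. l (\<lambda>x. u x + v x) = l u + l v) \<and>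
     (\<forall>c. \<forall>u\<in>Sobolev_space_0 S. l (\<lambda>x. c * u x) = c * l u) \<and>
     (\<exists>C. \<forall>u\<in>Sobolev_space_0 S. cmod (l u) \<le> C * Sobolev_norm S u)}"

text \<open>The dual of \<open>Sobolev_space_0 S\<close>, viewed as a set of distributions by restricting
  functionals to test functions.\<close>

definition Sobolev_neg_space :: "real set \<Rightarrow> ((real \<Rightarrow> complex) \<Rightarrow> complex) set" where
  "Sobolev_neg_space S = {T. distribution_on S T \<and>
     (\<exists>l\<in>Sobolev_dual S. \<forall>\<phi>\<in>test_functions S. T \<phi> = l \<phi>)}"

end

theory Submission
  imports Defs
begin

text \<open>Let \<open>F\<close> be a primitive of \<open>f \<in> A\<^sup>2(D)\<close>. Averaging Cauchy's formula over concentric squares gives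
  \<open>\<bar>f(x)\<bar> \<le> C / d(x)\<close> on the interval, where \<open>d\<close> is the distance to the endpoints. Hence \<open>F\<close> grows
  only logarithmically at the endpoints, so it is square integrable, and \<open>f = F'\<close> is the
  distribution \<open>\<phi> \<mapsto> - \<integral> F \<phi>'\<close>. It extends to the functional \<open>u \<mapsto> - \<integral> F u'\<close> with the weak derivative
  \<open>u'\<close>. Linearity of that functional rests on the uniqueness of weak derivatives up to null sets.\<close>

subsection \<open>Pointwise bound for Bergman functions\<close>

text \<open>The bound by 1 / d depends on the shape of \<open>D\<close>: it is a square with
  opposite corners at the two endpoints, so a real point x has distance d(x) / sqrt 2 from the
  boundary, and an axis-parallel square of side comparable to d(x) fits around it. Squares are used
  instead of discs because averaging over them reduces to iterated integrals over intervals. The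
  obstacle is that 1 / d is not square integrable at the endpoints, so the pointwise bound does not
  place f itself in L^2 of the interval. One integration weakens the singularity enough. Uniqueness
  of weak derivatives is the fundamental lemma of the calculus of variations. It is derived from
  explicit bump functions that converge boundedly to indicators of intervals, in place of
  mollification.\<close>

lemma distr_lborel_Complex:
  "distr (lborel :: (real \<times> real) measure) borel (\<lambda>(x, y). Complex x y) = lborel"
proof (rule sym, rule lborel_eqI)
  fix l u :: complex
  assume lu: "\<And>b. b \<in> Basis \<Longrightarrow> l \<bullet> b \<le> u \<bullet> b"
  have [measurable]: "(\<lambda>(x, y). Complex x y) \<in> borel_measurable (borel :: (real \<times> real) measure)"
    by (intro borel_measurable_continuous_onI)
      (auto simp: case_prod_unfold Complex_eq intro!: continuous_intros)
  have le: "Re l \<le> Re u" "Im l \<le> Im u"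
    using lu[of 1] lu[of \<i>] by (auto simp: Basis_complex_def)
  have "box (Re l, Im l) (Re u, Im u) = box (Re l) (Re u) \<times> box (Im l) (Im u)"
    by (auto simp: box_def Basis_prod_def)
  then have "(\<lambda>(x, y). Complex x y) -` box l u = box (Re l, Im l) (Re u, Im u)"
    by (auto simp: in_box_complex_iff)
  then have "emeasure (distr lborel borel (\<lambda>(x, y). Complex x y)) (box l u)
      = emeasure lborel (box (Re l, Im l) (Re u, Im u))"
    by (simp add: emeasure_distr)
  also have "\<dots> = ennreal (\<Prod>b\<in>Basis. ((Re u, Im u) - (Re l, Im l)) \<bullet> b)"
    using le by (intro emeasure_lborel_box) (auto simp: Basis_prod_def)
  also have "(\<Prod>b\<in>Basis. ((Re u, Im u) - (Re l, Im l)) \<bullet> b) = (\<Prod>b\<in>Basis. (u - l) \<bullet> b)"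
  proof -
    have B: "(Basis :: (real \<times> real) set) = {(1, 0), (0, 1)}"
      by (auto simp: Basis_prod_def)
    show ?thesis
      unfolding Basis_complex_def B by simp
  qed
  finally show "emeasure (distr lborel borel (\<lambda>(x, y). Complex x y)) (box l u)
      = ennreal (\<Prod>b\<in>Basis. (u - l) \<bullet> b)" .
qed simp

lemma continuous_on_Complex_cbox:
  assumes "continuous_on (cbox p q) g"
  shows "continuous_on (cbox (Re p, Im p) (Re q, Im q)) (\<lambda>(x, y). g (Complex x y))"
  unfolding case_prod_unfold
  by (rule continuous_on_compose2[OF assms])
    (auto simp: in_cbox_complex_iff Complex_eq cbox_Pair_eq intro!: continuous_intros)

text \<open>The Bergman norm is an integral over complex numbers, while the averaging argument works
  with iterated integrals in two real variables. The measure-preserving map \<open>(x, y)\<close> to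
  \<open>Complex x y\<close> connects the two, and nonnegativity allows the domain to grow from the
  box to \<open>S\<close>.\<close>

lemma integral_Complex_cbox_le:
  fixes g :: "complex \<Rightarrow> real"
  assumes S: "S \<in> sets lebesgue" "cbox p q \<subseteq> S"
    and int: "integrable (lebesgue_on S) g" and cont: "continuous_on (cbox p q) g"
    and nonneg: "\<And>z. z \<in> S \<Longrightarrow> 0 \<le> g z"
  shows "integral (cbox (Re p, Im p) (Re q, Im q)) (\<lambda>(x, y). g (Complex x y))
    \<le> (LINT z|lebesgue_on S. g z)"
proof -
  let ?R = "cbox (Re p, Im p) (Re q, Im q)"
  let ?h = "\<lambda>z. indicator (cbox p q) z *\<^sub>R g z"
  have [measurable]: "(\<lambda>(x, y). Complex x y) \<in> borel_measurable (borel :: (real \<times> real) measure)"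
    by (intro borel_measurable_continuous_onI)
      (auto simp: case_prod_unfold Complex_eq intro!: continuous_intros)
  have inth: "integrable lborel ?h"
    by (rule borel_integrable_compact[OF compact_cbox cont])
  have "integral ?R (\<lambda>(x, y). g (Complex x y)) = (LINT w:?R|lborel. case w of (x, y) \<Rightarrow> g (Complex x y))"
    by (rule set_borel_integral_eq_integral(2)[symmetric], unfold set_integrable_def)
      (rule borel_integrable_compact[OF compact_cbox continuous_on_Complex_cbox[OF cont]])
  also have "\<dots> = (LINT w|lborel. ?h (case w of (x, y) \<Rightarrow> Complex x y))"
    unfolding set_lebesgue_integral_def
    by (intro Bochner_Integration.integral_cong)
      (auto simp: indicator_def in_cbox_complex_iff cbox_Pair_eq)
  also have "\<dots> = (LINT z|distr lborel borel (\<lambda>(x, y). Complex x y). ?h z)"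
    using inth by (intro integral_distr[symmetric]) auto
  also have "\<dots> = (LINT z|lborel. ?h z)"
    by (simp only: distr_lborel_Complex)
  also have "\<dots> = (LINT z|lebesgue. ?h z)"
    using inth by (intro integral_completion[symmetric]) auto
  also have "\<dots> \<le> (LINT z|lebesgue. indicator S z *\<^sub>R g z)"
  proof (rule integral_mono)
    show "integrable lebesgue ?h"
      using inth by (subst integrable_completion) auto
    show "integrable lebesgue (\<lambda>z. indicator S z *\<^sub>R g z)"
      using int S by (subst (asm) integrable_restrict_space) auto
  qed (use S nonneg in \<open>auto simp: indicator_def\<close>)
  also have "\<dots> = (LINT z|lebesgue_on S. g z)"
    using S by (subst integral_restrict_space) auto
  finally show ?thesis .
qed

lemma norm_contour_integral_vertical_le:
  fixes g :: "complex \<Rightarrow> complex"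
  assumes "a < b" and g: "continuous_on (closed_segment (Complex c a) (Complex c b)) g"
    and h: "h integrable_on {a..b}" and le: "\<And>y. y \<in> {a..b} \<Longrightarrow> cmod (g (Complex c y)) \<le> h y"
  shows "cmod (contour_integral (linepath (Complex c a) (Complex c b)) g) \<le> integral {a..b} h"
proof -
  have "contour_integral (linepath (Complex c a) (Complex c b)) g
      = \<i> * integral {a..b} (\<lambda>y. g (Complex c y))"
    using \<open>a < b\<close> by (intro contour_integral_linepath_same_Re) auto
  moreover have "(\<lambda>y. g (Complex c y)) integrable_on {a..b}"
    by (intro integrable_continuous_real continuous_on_compose2[OF g])
      (auto simp: Complex_eq closed_segment_same_Re closed_segment_eq_real_ivl intro!: continuous_intros)
  ultimately show ?thesis
    using integral_norm_bound_integral[OF _ h le] by (simp add: norm_mult)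
qed

lemma norm_contour_integral_horizontal_le:
  fixes g :: "complex \<Rightarrow> complex"
  assumes "a < b" and g: "continuous_on (closed_segment (Complex a c) (Complex b c)) g"
    and h: "h integrable_on {a..b}" and le: "\<And>x. x \<in> {a..b} \<Longrightarrow> cmod (g (Complex x c)) \<le> h x"
  shows "cmod (contour_integral (linepath (Complex a c) (Complex b c)) g) \<le> integral {a..b} h"
proof -
  have "contour_integral (linepath (Complex a c) (Complex b c)) g
      = contour_integral (linepath (of_real a) (of_real b)) (\<lambda>w. g (w + \<i> * of_real c))"
    by (simp add: contour_integral_integral linepath_def Complex_eq algebra_simps)
  also have "\<dots> = integral {a..b} (\<lambda>x. g (Complex x c))"
    using \<open>a < b\<close> by (subst contour_integral_linepath_Reals_eq) (auto simp: Complex_eq)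
  finally have "contour_integral (linepath (Complex a c) (Complex b c)) g
    = integral {a..b} (\<lambda>x. g (Complex x c))" .
  moreover have "(\<lambda>x. g (Complex x c)) integrable_on {a..b}"
    by (intro integrable_continuous_real continuous_on_compose2[OF g])
      (auto simp: Complex_eq closed_segment_same_Im closed_segment_eq_real_ivl intro!: continuous_intros)
  ultimately show ?thesis
    using integral_norm_bound_integral[OF _ h le] by simp
qed

text \<open>On the boundary of the square of half-side \<open>t\<close> the Cauchy kernel is at most
  1 / t, hence at most 1 / r. The sides are lengthened to the fixed length 2 R, so that
  \<open>H\<close> and \<open>V\<close> do not depend on \<open>t\<close> and the estimate can be
  integrated over \<open>t\<close>.\<close>

lemma Cauchy_rectangle_bound:
  assumes S: "open S" "cbox (Complex (x - R) (y - R)) (Complex (x + R) (y + R)) \<subseteq> S"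
    and f: "f holomorphic_on S" and t: "0 < r" "r \<le> t" "t \<le> R"
  defines "H \<equiv> (\<lambda>v. integral {x - R..x + R} (\<lambda>u. cmod (f (Complex u v))))"
    and "V \<equiv> (\<lambda>u. integral {y - R..y + R} (\<lambda>v. cmod (f (Complex u v))))"
  shows "2 * pi * r * cmod (f (Complex x y)) \<le> H (y - t) + H (y + t) + V (x - t) + V (x + t)"
proof -
  let ?Q = "cbox (Complex (x - R) (y - R)) (Complex (x + R) (y + R))"
  let ?Qt = "cbox (Complex (x - t) (y - t)) (Complex (x + t) (y + t))"
  let ?z = "Complex x y"
  let ?g = "\<lambda>w. f w / (w - ?z)"
  have QS: "?Qt \<subseteq> ?Q" using t by (auto simp: in_cbox_complex_iff)
  have cf: "continuous_on ?Q f"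
    using f S holomorphic_on_imp_continuous_on continuous_on_subset by blast
  have intH: "(\<lambda>u. cmod (f (Complex u v))) integrable_on {x - R..x + R}" if "v \<in> {y - R..y + R}" for v
    by (intro integrable_continuous_real continuous_on_norm continuous_on_compose2[OF cf])
      (use that in \<open>auto simp: Complex_eq in_cbox_complex_iff intro!: continuous_intros\<close>)
  have intV: "(\<lambda>v. cmod (f (Complex u v))) integrable_on {y - R..y + R}" if "u \<in> {x - R..x + R}" for u
    by (intro integrable_continuous_real continuous_on_norm continuous_on_compose2[OF cf])
      (use that in \<open>auto simp: Complex_eq in_cbox_complex_iff intro!: continuous_intros\<close>)
  have intH': "(\<lambda>u. cmod (f (Complex u v))) integrable_on {x - t..x + t}" if "v \<in> {y - R..y + R}" for v
    using integrable_on_subinterval[OF intH[OF that]] t by auto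
  have intV': "(\<lambda>v. cmod (f (Complex u v))) integrable_on {y - t..y + t}" if "u \<in> {x - R..x + R}" for u
    using integrable_on_subinterval[OF intV[OF that]] t by auto
  have cg: "continuous_on (?Q - {?z}) ?g"
    by (intro continuous_intros continuous_on_subset[OF cf]) auto
  have gle: "cmod (?g w) \<le> cmod (f w) / r" if "r \<le> \<bar>Re w - x\<bar> \<or> r \<le> \<bar>Im w - y\<bar>" for w
  proof -
    have "r \<le> cmod (w - ?z)"
      using that abs_Re_le_cmod[of "w - ?z"] abs_Im_le_cmod[of "w - ?z"] by auto
    then show ?thesis
      using t by (auto simp: norm_divide intro!: divide_left_mono mult_pos_pos)
  qed
  have segH: "closed_segment (Complex (x - t) v) (Complex (x + t) v) \<subseteq> ?Q - {?z}" if "v = y - t \<or> v = y + t" for v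
    using that t by (auto simp: closed_segment_same_Im in_cbox_complex_iff closed_segment_eq_real_ivl)
  have segV: "closed_segment (Complex u (y - t)) (Complex u (y + t)) \<subseteq> ?Q - {?z}" if "u = x - t \<or> u = x + t" for u
    using that t by (auto simp: closed_segment_same_Re in_cbox_complex_iff closed_segment_eq_real_ivl)
  have bH: "cmod (contour_integral (linepath (Complex (x - t) v) (Complex (x + t) v)) ?g) \<le> H v / r"
    if v: "v = y - t \<or> v = y + t" for v
  proof -
    have v': "v \<in> {y - R..y + R}" using v t by auto
    have "cmod (contour_integral (linepath (Complex (x - t) v) (Complex (x + t) v)) ?g)
        \<le> integral {x - t..x + t} (\<lambda>u. cmod (f (Complex u v)) / r)"
      using v t intH'[OF v']
      by (intro norm_contour_integral_horizontal_le continuous_on_subset[OF cg segH] gle)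
        (auto intro: integrable_on_divide)
    also have "\<dots> = integral {x - t..x + t} (\<lambda>u. cmod (f (Complex u v))) / r"
      by simp
    also have "\<dots> \<le> H v / r"
      unfolding H_def using t intH[OF v'] intH'[OF v']
      by (intro divide_right_mono integral_subset_le) auto
    finally show ?thesis .
  qed
  have bV: "cmod (contour_integral (linepath (Complex u (y - t)) (Complex u (y + t))) ?g) \<le> V u / r"
    if u: "u = x - t \<or> u = x + t" for u
  proof -
    have u': "u \<in> {x - R..x + R}" using u t by auto
    have "cmod (contour_integral (linepath (Complex u (y - t)) (Complex u (y + t))) ?g)
        \<le> integral {y - t..y + t} (\<lambda>v. cmod (f (Complex u v)) / r)"
      using u t intV'[OF u']
      by (intro norm_contour_integral_vertical_le continuous_on_subset[OF cg segV] gle)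
        (auto intro: integrable_on_divide)
    also have "\<dots> = integral {y - t..y + t} (\<lambda>v. cmod (f (Complex u v))) / r"
      by simp
    also have "\<dots> \<le> V u / r"
      unfolding V_def using t intV[OF u'] intV'[OF u']
      by (intro divide_right_mono integral_subset_le) auto
    finally show ?thesis .
  qed
  have zbox: "?z \<in> box (Complex (x - t) (y - t)) (Complex (x + t) (y + t))"
    using t by (auto simp: in_box_complex_iff)
  have img: "path_image (rectpath (Complex (x - t) (y - t)) (Complex (x + t) (y + t))) \<subseteq> ?Qt - {?z}"
    using t zbox path_image_rectpath_cbox_minus_box[of "Complex (x - t) (y - t)" "Complex (x + t) (y + t)"]
    by auto
  have "(?g has_contour_integral
      (2 * pi * \<i> * winding_number (rectpath (Complex (x - t) (y - t)) (Complex (x + t) (y + t))) ?z * f ?z))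
      (rectpath (Complex (x - t) (y - t)) (Complex (x + t) (y + t)))"
    by (intro Cauchy_integral_formula_convex_simple[where S = ?Qt] holomorphic_on_subset[OF f] img)
      (use zbox QS S in \<open>auto simp: interior_cbox\<close>)
  then have main: "contour_integral (rectpath (Complex (x - t) (y - t)) (Complex (x + t) (y + t))) ?g
      = 2 * pi * \<i> * f ?z"
    using winding_number_rectpath[OF zbox] by (simp add: contour_integral_unique)
  have ciH: "?g contour_integrable_on linepath (Complex (x - t) v) (Complex (x + t) v)"
    if "v = y - t \<or> v = y + t" for v
    by (intro contour_integrable_continuous_linepath continuous_on_subset[OF cg segH[OF that]])
  have ciV: "?g contour_integrable_on linepath (Complex u (y - t)) (Complex u (y + t))"
    if "u = x - t \<or> u = x + t" for u
    by (intro contour_integrable_continuous_linepath continuous_on_subset[OF cg segV[OF that]])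
  have ciH': "?g contour_integrable_on linepath (Complex (x + t) v) (Complex (x - t) v)"
    if "v = y - t \<or> v = y + t" for v
    using ciH[OF that] has_contour_integral_reverse_linepath contour_integrable_on_def by blast
  have ciV': "?g contour_integrable_on linepath (Complex u (y + t)) (Complex u (y - t))"
    if "u = x - t \<or> u = x + t" for u
    using ciV[OF that] has_contour_integral_reverse_linepath contour_integrable_on_def by blast
  have "contour_integral (rectpath (Complex (x - t) (y - t)) (Complex (x + t) (y + t))) ?g
     = contour_integral (linepath (Complex (x - t) (y - t)) (Complex (x + t) (y - t))) ?g
     + (contour_integral (linepath (Complex (x + t) (y - t)) (Complex (x + t) (y + t))) ?g
     + (contour_integral (linepath (Complex (x + t) (y + t)) (Complex (x - t) (y + t))) ?g
     + contour_integral (linepath (Complex (x - t) (y + t)) (Complex (x - t) (y - t))) ?g))"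
    unfolding rectpath_def Let_def complex.sel using ciH ciV ciH' ciV'
    by (simp add: contour_integral_join contour_integrable_joinI valid_path_join)
  \<comment> \<open>The top and the left side are traversed backwards. Reversing them brings all
    four sides into the form of \<open>bH\<close> and \<open>bV\<close>.\<close>
  also have "\<dots> = contour_integral (linepath (Complex (x - t) (y - t)) (Complex (x + t) (y - t))) ?g
     + contour_integral (linepath (Complex (x + t) (y - t)) (Complex (x + t) (y + t))) ?g
     - contour_integral (linepath (Complex (x - t) (y + t)) (Complex (x + t) (y + t))) ?g
     - contour_integral (linepath (Complex (x - t) (y - t)) (Complex (x - t) (y + t))) ?g"
    using contour_integral_reverse_linepath[OF continuous_on_subset[OF cg segH[of "y + t"]]]
      contour_integral_reverse_linepath[OF continuous_on_subset[OF cg segV[of "x - t"]]] by simp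
  finally have "2 * pi * \<i> * f ?z = \<dots>" using main by simp
  then have "cmod (2 * pi * \<i> * f ?z) \<le> cmod (contour_integral (linepath (Complex (x - t) (y - t)) (Complex (x + t) (y - t))) ?g)
     + cmod (contour_integral (linepath (Complex (x + t) (y - t)) (Complex (x + t) (y + t))) ?g)
     + cmod (contour_integral (linepath (Complex (x - t) (y + t)) (Complex (x + t) (y + t))) ?g)
     + cmod (contour_integral (linepath (Complex (x - t) (y - t)) (Complex (x - t) (y + t))) ?g)"
    by (simp only:) (smt (verit) norm_triangle_ineq norm_triangle_ineq4)
  also have "\<dots> \<le> H (y - t) / r + V (x + t) / r + H (y + t) / r + V (x - t) / r"
    by (intro add_mono bH bV) auto
  finally show ?thesis
    using t by (simp add: norm_mult field_simps)
qed

text \<open>As \<open>t\<close> runs through \<open>{r..2 * r}\<close>, the points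
  \<open>c - t\<close> and \<open>c + t\<close> sweep out the two outer quarters of the interval.
  The middle half is added by nonnegativity.\<close>

lemma integral_symmetric_halves_le:
  fixes h :: "real \<Rightarrow> real"
  assumes r: "0 < r" and cont: "continuous_on {c - 2 * r..c + 2 * r} h"
    and nonneg: "\<And>x. x \<in> {c - 2 * r..c + 2 * r} \<Longrightarrow> 0 \<le> h x"
  shows "integral {r..2 * r} (\<lambda>t. h (c - t) + h (c + t)) \<le> integral {c - 2 * r..c + 2 * r} h"
proof -
  have int: "h integrable_on {a..b}" if "c - 2 * r \<le> a" "b \<le> c + 2 * r" for a b
    by (rule integrable_continuous_real, rule continuous_on_subset[OF cont]) (use that in auto)
  have "((\<lambda>t. h (c + t)) has_integral integral {c + r..c + 2 * r} h) {r..2 * r}"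
  proof -
    have "(h has_integral integral {c + r..c + 2 * r} h) (cbox (c + r) (c + 2 * r))"
      using int[of "c + r" "c + 2 * r"] r by (simp add: has_integral_integral)
    from has_integral_affinity[OF this, of 1 c]
    show ?thesis by (simp add: add.commute)
  qed
  moreover have "((\<lambda>t. h (c - t)) has_integral integral {c - 2 * r..c - r} h) {r..2 * r}"
  proof -
    have "(h has_integral integral {c - 2 * r..c - r} h) (cbox (c - 2 * r) (c - r))"
      using int[of "c - 2 * r" "c - r"] r by (simp add: has_integral_integral)
    from has_integral_affinity[OF this, of "- 1" c]
    show ?thesis using r by (simp add: image_affinity_atLeastAtMost_diff)
  qed
  ultimately have "integral {r..2 * r} (\<lambda>t. h (c - t) + h (c + t))
      = integral {c - 2 * r..c - r} h + integral {c + r..c + 2 * r} h"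
    by (intro integral_unique has_integral_add)
  also have "\<dots> \<le> integral {c - 2 * r..c - r} h + (integral {c - r..c + r} h + integral {c + r..c + 2 * r} h)"
    using nonneg r by (auto intro!: integral_nonneg int)
  also have "\<dots> = integral {c - 2 * r..c + 2 * r} h"
    using r by (simp add: Henstock_Kurzweil_Integration.integral_combine int)
  finally show ?thesis .
qed

text \<open>Averaging \<open>Cauchy_rectangle_bound\<close> over half-sides between r and 2 r
  replaces the four line integrals by two copies of the area integral of \<open>cmod f\<close>, one
  from \<open>H\<close> and one from \<open>V\<close>. Each copy is at most 8 r + r N / 2, where N
  is the integral of the squared modulus, whence 16 + N. The bound is not homogeneous in
  \<open>f\<close>; what the inclusion uses is its growth of order 1 / r.\<close>

lemma Bergman_pointwise_bound:
  assumes S: "open S" "cbox (Complex (x - 2 * r) (y - 2 * r)) (Complex (x + 2 * r) (y + 2 * r)) \<subseteq> S"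
    and f: "f holomorphic_on S" and r: "0 < r"
    and int: "integrable (lebesgue_on S) (\<lambda>z. (cmod (f z))\<^sup>2)"
  shows "cmod (f (Complex x y)) \<le> (16 + (LINT z|lebesgue_on S. (cmod (f z))\<^sup>2)) / (2 * pi * r)"
proof -
  let ?Q = "cbox (Complex (x - 2 * r) (y - 2 * r)) (Complex (x + 2 * r) (y + 2 * r))"
  let ?R = "cbox (x - 2 * r, y - 2 * r) (x + 2 * r, y + 2 * r)"
  let ?N = "LINT z|lebesgue_on S. (cmod (f z))\<^sup>2"
  define H where "H = (\<lambda>v. integral {x - 2 * r..x + 2 * r} (\<lambda>u. cmod (f (Complex u v))))"
  define V where "V = (\<lambda>u. integral {y - 2 * r..y + 2 * r} (\<lambda>v. cmod (f (Complex u v))))"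
  let ?I = "integral ?R (\<lambda>(u, v). cmod (f (Complex u v)))"
  have cf: "continuous_on ?Q f"
    using f S holomorphic_on_imp_continuous_on continuous_on_subset by blast
  have cf1: "continuous_on ?R (\<lambda>(u, v). cmod (f (Complex u v)))"
    using continuous_on_Complex_cbox[OF continuous_on_norm[OF cf]] by simp
  have cf2: "continuous_on ?R (\<lambda>(u, v). (cmod (f (Complex u v)))\<^sup>2)"
    using continuous_on_Complex_cbox[OF continuous_on_power[OF continuous_on_norm[OF cf], of 2]] by simp
  have cV: "continuous_on {x - 2 * r..x + 2 * r} V"
    unfolding V_def box_real[symmetric]
    by (rule integral_continuous_on_param) (use cf1 in \<open>simp add: cbox_Pair_eq\<close>)
  have swap: "continuous_on ({y - 2 * r..y + 2 * r} \<times> {x - 2 * r..x + 2 * r}) (\<lambda>(v, u). cmod (f (Complex u v)))"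
    unfolding case_prod_unfold
    by (rule continuous_on_compose2[OF cf1[unfolded case_prod_unfold], where f = prod.swap, simplified])
      (auto simp: cbox_Pair_eq intro!: continuous_intros continuous_on_swap)
  have cH: "continuous_on {y - 2 * r..y + 2 * r} H"
    unfolding H_def box_real[symmetric]
    by (rule integral_continuous_on_param) (use swap in simp)
  have IV: "integral {x - 2 * r..x + 2 * r} V = ?I"
    using integral_prod_continuous[OF cf1] by (simp add: V_def)
  have IH: "integral {y - 2 * r..y + 2 * r} H = ?I"
    using integral_swap_continuous[OF cf1] IV by (simp add: V_def H_def)
  \<comment> \<open>The integral of a non-integrable function is 0 by convention, so
    \<open>V\<close> and \<open>H\<close> are nonnegative at every argument, also where the line
    leaves the square.\<close>
  have "0 \<le> integral A (\<lambda>x. cmod (g x))" for A :: "real set" and g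
    by (cases "(\<lambda>x. cmod (g x)) integrable_on A") (auto simp: integral_nonneg not_integrable_integral)
  then have Vn: "0 \<le> V u" and Hn: "0 \<le> H v" for u v
    by (simp_all add: V_def H_def)
  \<comment> \<open>The extra factor \<open>r\<close> is the length of the interval
    \<open>{r..2 * r}\<close> over which \<open>t\<close> is averaged.\<close>
  have "r * (2 * pi * r * cmod (f (Complex x y)))
      = integral {r..2 * r} (\<lambda>t. 2 * pi * r * cmod (f (Complex x y)))"
    using r by simp
  also have "\<dots> \<le> integral {r..2 * r} (\<lambda>t. (H (y - t) + H (y + t)) + (V (x - t) + V (x + t)))"
  proof (rule integral_le)
    show "(\<lambda>t. H (y - t) + H (y + t) + (V (x - t) + V (x + t))) integrable_on {r..2 * r}"
      using r by (intro integrable_continuous_real continuous_intros continuous_on_compose2[OF cV]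
        continuous_on_compose2[OF cH]) auto
    show "2 * pi * r * cmod (f (Complex x y)) \<le> H (y - t) + H (y + t) + (V (x - t) + V (x + t))"
      if "t \<in> {r..2 * r}" for t
      using Cauchy_rectangle_bound[OF S f r, of t] that by (simp add: H_def V_def)
  qed auto
  also have "\<dots> = integral {r..2 * r} (\<lambda>t. H (y - t) + H (y + t)) + integral {r..2 * r} (\<lambda>t. V (x - t) + V (x + t))"
    using r by (intro integral_add integrable_continuous_real continuous_intros continuous_on_compose2[OF cV]
        continuous_on_compose2[OF cH]) auto
  also have "\<dots> \<le> ?I + ?I"
    using integral_symmetric_halves_le[OF r cH Hn] integral_symmetric_halves_le[OF r cV Vn] IH IV by simp
  also have "?I \<le> integral ?R (\<lambda>w. 1 / (2 * r) + r / 2 * (case w of (u, v) \<Rightarrow> (cmod (f (Complex u v)))\<^sup>2))"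
  proof (rule integral_le)
    \<comment> \<open>AM-GM with the scale of the square, which makes the bound proportional to \<open>1 / r\<close>.\<close>
    show "(case w of (u, v) \<Rightarrow> cmod (f (Complex u v)))
        \<le> 1 / (2 * r) + r / 2 * (case w of (u, v) \<Rightarrow> (cmod (f (Complex u v)))\<^sup>2)" for w
    proof (cases w)
      case (Pair u v)
      define m where "m = cmod (f (Complex u v))"
      have "0 \<le> (r * m - 1)\<^sup>2" by simp
      then have "m \<le> 1 / (2 * r) + r / 2 * m\<^sup>2"
        using r by (simp add: field_simps power2_eq_square)
      then show ?thesis by (simp add: Pair m_def)
    qed
  qed (intro integrable_continuous cf1 continuous_intros cf2)+
  also have "\<dots> = integral ?R (\<lambda>w. 1 / (2 * r)) + r / 2 * integral ?R (\<lambda>(u, v). (cmod (f (Complex u v)))\<^sup>2)"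
    by (subst integral_add) (auto intro!: integrable_continuous continuous_intros cf2)
  \<comment> \<open>The square has side 4 r, hence area 16 r^2.\<close>
  also have "integral ?R (\<lambda>w. 1 / (2 * r)) = 8 * r"
    using r by (simp add: content_Pair)
  also have "integral ?R (\<lambda>(u, v). (cmod (f (Complex u v)))\<^sup>2) \<le> ?N"
    using integral_Complex_cbox_le[OF _ S(2) int continuous_on_power[OF continuous_on_norm[OF cf]]] S(1) by simp
  finally have "r * (2 * pi * r * cmod (f (Complex x y))) \<le> r * (16 + ?N)"
    using r by (simp add: field_simps)
  then have "2 * pi * r * cmod (f (Complex x y)) \<le> 16 + ?N"
    using r by (simp only: mult_le_cancel_left_pos)
  then show ?thesis
    using r by (simp add: field_simps)
qed

subsection \<open>Smooth bump functions\<close>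

text \<open>A single term of the series of exp (c s) is at most the whole sum.\<close>

lemma power_times_exp_bounded:
  fixes s c :: real
  assumes "0 < c" "0 \<le> s"
  shows "s ^ k * exp (- c * s) \<le> fact k / c ^ k"
proof -
  have "(\<Sum>n\<in>{k}. (c * s) ^ n /\<^sub>R fact n) \<le> (\<Sum>n. (c * s) ^ n /\<^sub>R fact n)"
    using assms by (intro sum_le_suminf summable_exp_generic) auto
  then have "(c * s) ^ k / fact k \<le> exp (c * s)"
    by (simp add: exp_def divide_inverse_commute)
  then show ?thesis
    using assms by (simp add: exp_minus field_simps power_mult_distrib)
qed

text \<open>The class of functions \<open>p s\<^sup>k exp (- c s)\<close> with \<open>s = 1 / ((x - a) (b - x))\<close> and \<open>p\<close> polynomial is closed
  under differentiation, which yields smoothness without computing higher derivatives.\<close>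

definition bump :: "real \<Rightarrow> real \<Rightarrow> real \<Rightarrow> real poly \<Rightarrow> nat \<Rightarrow> real \<Rightarrow> real" where
  "bump a b c p k x = (if a < x \<and> x < b
     then poly p x * (1 / ((x - a) * (b - x))) ^ k * exp (- c * (1 / ((x - a) * (b - x)))) else 0)"

text \<open>Raising the exponent splits off a factor that vanishes at both endpoints, while the
  remaining factor stays in the same bounded class. Continuity and differentiability at the
  endpoints both come from this.\<close>

lemma bump_Suc: "bump a b c p k x = (x - a) * (b - x) * bump a b c p (Suc k) x"
  by (simp add: bump_def)

lemma bump_bounded:
  assumes "0 < c"
  obtains M where "\<And>x. \<bar>bump a b c p k x\<bar> \<le> M"
proof -
  have "bounded (poly p ` {a..b})"
    by (intro compact_imp_bounded compact_continuous_image continuous_intros) auto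
  then obtain P where P: "\<forall>x\<in>{a..b}. \<bar>poly p x\<bar> \<le> P"
    unfolding bounded_iff by auto
  have "\<bar>bump a b c p k x\<bar> \<le> \<bar>P\<bar> * (fact k / c ^ k)" for x
  proof (cases "a < x \<and> x < b")
    case True
    define s where "s = 1 / ((x - a) * (b - x))"
    have s: "0 \<le> s" using True by (simp add: s_def)
    have "\<bar>bump a b c p k x\<bar> = \<bar>poly p x\<bar> * (s ^ k * exp (- c * s))"
      using True s by (simp add: bump_def s_def[symmetric] abs_mult)
    also have "\<dots> \<le> \<bar>P\<bar> * (fact k / c ^ k)"
      using bspec[OF P, of x] True power_times_exp_bounded[OF assms s, of k] s
      by (intro mult_mono) auto
    finally show ?thesis .
  qed (use assms in \<open>auto simp: bump_def\<close>)
  then show ?thesis by (rule that)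
qed

lemma bump_isCont_endpoint:
  assumes "0 < c" "x = a \<or> x = b"
  shows "isCont (bump a b c p k) x"
proof -
  obtain M where M: "\<And>x. \<bar>bump a b c p (Suc k) x\<bar> \<le> M"
    using bump_bounded[OF assms(1)] by blast
  have "((\<lambda>y. (y - a) * (b - y) * bump a b c p (Suc k) y) \<longlongrightarrow> 0) (at x)"
  proof (rule Lim_null_comparison)
    show "\<forall>\<^sub>F y in at x. norm ((y - a) * (b - y) * bump a b c p (Suc k) y) \<le> \<bar>(y - a) * (b - y)\<bar> * M"
      using M by (auto simp: abs_mult intro!: always_eventually mult_left_mono)
    have "((\<lambda>y. \<bar>(y - a) * (b - y)\<bar> * M) \<longlongrightarrow> \<bar>(x - a) * (b - x)\<bar> * M) (at x)"
      by (intro tendsto_intros)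
    then show "((\<lambda>y. \<bar>(y - a) * (b - y)\<bar> * M) \<longlongrightarrow> 0) (at x)"
      using assms by auto
  qed
  moreover have "bump a b c p k = (\<lambda>y. (y - a) * (b - y) * bump a b c p (Suc k) y)"
    by (rule ext) (rule bump_Suc)
  moreover have "bump a b c p k x = 0"
    using assms by (auto simp: bump_def)
  ultimately show ?thesis
    unfolding isCont_def by metis
qed

text \<open>Write m = (x - a) (b - x), s = 1 / m and q = 2 x - a - b, so that s' = q s^2. Then the
  derivative of p s^k exp (- c s) is (p' m^2 + k p q m - c p q) s^(k + 2) exp (- c s). The powers of
  m bring all three terms to the common exponent k + 2, and the bracket is this polynomial.\<close>

definition bump_deriv_poly :: "real \<Rightarrow> real \<Rightarrow> real \<Rightarrow> real poly \<Rightarrow> nat \<Rightarrow> real poly" where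
  "bump_deriv_poly a b c p k =
     pderiv p * ([:- a, 1:] * [:b, -1:]) ^ 2
     + smult (real k) (p * [:- a - b, 2:] * ([:- a, 1:] * [:b, -1:])) - smult c (p * [:- a - b, 2:])"

lemma bump_has_derivative:
  assumes "0 < c"
  shows "(bump a b c p k has_real_derivative bump a b c (bump_deriv_poly a b c p k) (k + 2) x) (at x)"
proof -
  consider "a < x" "x < b" | "x < a \<or> b < x \<or> b \<le> a" | "x = a \<or> x = b" "a < b" by linarith
  then show ?thesis
  proof cases
    case 1
    define s where "s = (\<lambda>y. 1 / ((y - a) * (b - y)))"
    define q where "q = 2 * x - a - b"
    define m where "m = (x - a) * (b - x)"
    have m: "m \<noteq> 0" "s x = 1 / m" using 1 by (auto simp: m_def s_def)
    have s': "(s has_real_derivative q * s x ^ 2) (at x)"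
      unfolding s_def q_def using 1
      by (auto intro!: derivative_eq_intros simp: power2_eq_square divide_simps)
    have "((\<lambda>y. poly p y * s y ^ k * exp (- c * s y)) has_real_derivative
        (poly (pderiv p) x * s x ^ k + poly p x * (k * s x ^ (k - 1) * (q * s x ^ 2))) * exp (- c * s x)
        + poly p x * s x ^ k * (exp (- c * s x) * (- c * (q * s x ^ 2)))) (at x)"
      by (auto intro!: derivative_eq_intros s' poly_DERIV simp: algebra_simps)
    \<comment> \<open>For \<open>k = 0\<close> the truncated exponent \<open>k - 1\<close> does no
      harm, since the factor \<open>k\<close> vanishes.\<close>
    also have "k * s x ^ (k - 1) * (q * s x ^ 2) = k * q * s x ^ (k + 1)"
      by (cases k) (auto simp: power2_eq_square)
    also have "(poly (pderiv p) x * s x ^ k + poly p x * (k * q * s x ^ (k + 1))) * exp (- c * s x)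
        + poly p x * s x ^ k * (exp (- c * s x) * (- c * (q * s x ^ 2)))
      = (poly (pderiv p) x * m ^ 2 + k * poly p x * q * m - c * poly p x * q) * s x ^ (k + 2) * exp (- c * s x)"
      using m(1) by (simp add: m(2) field_simps power2_eq_square)
    also have "\<dots> = bump a b c (bump_deriv_poly a b c p k) (k + 2) x"
      using 1 by (simp add: bump_def bump_deriv_poly_def s_def m_def q_def algebra_simps power2_eq_square)
    finally have D: "((\<lambda>y. poly p y * s y ^ k * exp (- c * s y)) has_real_derivative
      bump a b c (bump_deriv_poly a b c p k) (k + 2) x) (at x)" .
    show ?thesis
      by (rule has_field_derivative_transform_within_open[OF D, of "{a<..<b}"])
        (use 1 in \<open>auto simp: bump_def s_def\<close>)
  next
    case 2
    have "((\<lambda>_. 0) has_real_derivative 0) (at x)" by simp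
    then have "(bump a b c p k has_real_derivative 0) (at x)"
      by (rule has_field_derivative_transform_within_open[of _ _ _ "if b \<le> a then UNIV else if x < a then {..<a} else {b<..}"])
        (use 2 in \<open>auto simp: bump_def\<close>)
    then show ?thesis using 2 by (auto simp: bump_def)
  next
    case 3
    \<comment> \<open>Caratheodory's criterion: by \<open>bump_Suc\<close> the increment is
      \<open>y - x\<close> times the other linear factor times a bump of exponent
      \<open>Suc k\<close>. This quotient is continuous and vanishes at the endpoint; for
      \<open>x = b\<close> the sign is absorbed by writing \<open>a - y\<close>.\<close>
    let ?g = "\<lambda>y. (if x = a then b - y else a - y) * bump a b c p (Suc k) y"
    have "bump a b c p k y - bump a b c p k x = ?g y * (y - x)" for y
      using 3 bump_Suc[of a b c p k y] by (auto simp: bump_def[of _ _ _ _ _ x] algebra_simps)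
    moreover have "isCont ?g x"
      using 3 assms by (intro continuous_intros bump_isCont_endpoint) auto
    moreover have "?g x = 0" using 3 by (auto simp: bump_def)
    ultimately have "(bump a b c p k has_real_derivative 0) (at x)"
      unfolding CARAT_DERIV by (intro exI[of _ ?g]) simp
    then show ?thesis using 3 by (auto simp: bump_def)
  qed
qed

lemma vderiv_bump:
  assumes "0 < c"
  shows "vderiv (\<lambda>x. complex_of_real (bump a b c p k x))
    = (\<lambda>x. complex_of_real (bump a b c (bump_deriv_poly a b c p k) (k + 2) x))"
  unfolding vderiv_def
  by (intro ext vector_derivative_at has_vector_derivative_of_real)
    (use bump_has_derivative[OF assms] in \<open>simp add: has_real_derivative_iff_has_vector_derivative\<close>)

lemma bump_test_function:
  assumes "0 < c" "{a..b} \<subseteq> S"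
  shows "(\<lambda>x. complex_of_real (bump a b c p k x)) \<in> test_functions S"
proof -
  have "\<exists>q l. (vderiv ^^ n) (\<lambda>x. complex_of_real (bump a b c p k x)) = (\<lambda>x. complex_of_real (bump a b c q l x))" for n
  proof (induction n)
    case (Suc n)
    then show ?case
      by (auto simp: vderiv_bump[OF assms(1)] simp del: of_real_eq_iff) blast
  qed auto
  moreover have "(\<lambda>x. complex_of_real (bump a b c q l x)) differentiable (at x)" for q l x
    using bump_has_derivative[OF assms(1), of a b q l x]
    by (metis has_real_derivative_iff_has_vector_derivative has_vector_derivative_of_real differentiableI_vector)
  ultimately have "(vderiv ^^ n) (\<lambda>x. complex_of_real (bump a b c p k x)) differentiable (at x)" for n x
    by metis
  moreover have "bump a b c p k x = 0" if "x \<notin> {a..b}" for x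
    using that by (auto simp: bump_def)
  ultimately show ?thesis
    unfolding test_functions_def using assms(2) by (auto intro!: exI[of _ "{a..b}"])
qed

text \<open>Letting \<open>c\<close> tend to 0 flattens the bump, as exp (- c s) tends to 1 at each
  interior point. Together with the uniform bound 1, this makes dominated convergence
  applicable.\<close>

lemma bump_tendsto_indicator:
  "(\<lambda>n. bump a b (1 / Suc n) 1 0 x) \<longlonglongrightarrow> indicator {a<..<b} x"
proof (cases "a < x \<and> x < b")
  case True
  have "(\<lambda>n. exp (- (1 / Suc n) * (1 / ((x - a) * (b - x))))) \<longlonglongrightarrow> exp (- 0 * (1 / ((x - a) * (b - x))))"
    by (intro tendsto_intros LIMSEQ_Suc[OF lim_1_over_n])
  then show ?thesis using True by (simp add: bump_def)
qed (auto simp: bump_def)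

lemma bump_1_bounded: "0 < c \<Longrightarrow> \<bar>bump a b c 1 0 x\<bar> \<le> 1"
  by (auto simp: bump_def)

subsection \<open>Uniqueness of weak derivatives\<close>

lemma lebesgue_on_zero_outside:
  fixes h :: "'a::euclidean_space \<Rightarrow> 'b::{banach, second_countable_topology}"
  assumes "A \<subseteq> S" "A \<in> sets lebesgue" "S \<in> sets lebesgue" "\<And>x. x \<in> S - A \<Longrightarrow> h x = 0"
  shows "integrable (lebesgue_on S) h \<longleftrightarrow> integrable (lebesgue_on A) h"
    and "integral\<^sup>L (lebesgue_on S) h = integral\<^sup>L (lebesgue_on A) h"
proof -
  have "(\<lambda>x. indicator S x *\<^sub>R h x) = (\<lambda>x. indicator A x *\<^sub>R h x)"
    using assms by (auto simp: indicator_def fun_eq_iff)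
  then show "integrable (lebesgue_on S) h \<longleftrightarrow> integrable (lebesgue_on A) h"
    and "integral\<^sup>L (lebesgue_on S) h = integral\<^sup>L (lebesgue_on A) h"
    using assms by (simp_all add: integrable_restrict_space integral_restrict_space)
qed

text \<open>Dynkin's argument: closed intervals form an intersection-stable generator of the Borel
  sets, and the sets over which \<open>w\<close> integrates to 0 are closed under countable disjoint
  unions and, because the integral over the whole line is 0, under complements. A Lebesgue set
  differs from a Borel set by a null set, so \<open>density_zero\<close> applies.\<close>

lemma AE_eq_0_if_intervals:
  fixes w :: "real \<Rightarrow> 'b::{banach, second_countable_topology}"
  assumes int: "integrable lebesgue w"
    and w0: "\<And>a b. (LINT x:{a..b}|lebesgue. w x) = 0" "(LINT x|lebesgue. w x) = 0"
  shows "AE x in lebesgue. w x = 0"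
proof -
  have "sigma_finite_measure (lebesgue :: real measure)"
  proof (standard, intro exI conjI ballI)
    show "countable (range (\<lambda>n::nat. cball (0::real) n))" by simp
    show "range (\<lambda>n::nat. cball (0::real) n) \<subseteq> sets lebesgue" by auto
    show "(\<Union>n::nat. cball (0::real) n) = space lebesgue"
      using real_arch_simple by (auto simp: dist_real_def)
    show "emeasure lebesgue a \<noteq> \<infinity>" if "a \<in> range (\<lambda>n::nat. cball (0::real) n)" for a
      using that by (metis fmeasurableD2 imageE infinity_ennreal_def lmeasurable_cball)
  qed
  then interpret sigma_finite_measure "lebesgue :: real measure" .
  have borel0: "(LINT x:B|lebesgue. w x) = 0" if "B \<in> sets borel" for B
    using that
  proof (induction B rule: borel_set_induct)
    case (compl B)
    have "(LINT x:-B|lebesgue. w x) = (LINT x|lebesgue. w x - indicator B x *\<^sub>R w x)"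
      unfolding set_lebesgue_integral_def
      by (intro Bochner_Integration.integral_cong) (auto simp: indicator_def)
    also have "\<dots> = (LINT x|lebesgue. w x) - (LINT x:B|lebesgue. w x)"
      unfolding set_lebesgue_integral_def using compl(1)
      by (intro Bochner_Integration.integral_diff int integrable_mult_indicator) auto
    finally show ?case using compl w0 by simp
  next
    case (union f)
    have "(LINT x:(\<Union>i. f i)|lebesgue. w x) = (\<Sum>i. (LINT x:(f i)|lebesgue. w x))"
      using union unfolding disjoint_family_on_def
      by (intro lebesgue_integral_countable_add)
        (auto simp: set_integrable_def intro!: integrable_mult_indicator int)
    then show ?case using union by simp
  qed (use w0 in \<open>auto simp: set_lebesgue_integral_def\<close>)
  have "(LINT x:A|lebesgue. w x) = 0" if "A \<in> sets lebesgue" for A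
  proof -
  from that obtain B N N' where A: "A = B \<union> N" "N \<subseteq> N'" "N' \<in> null_sets lborel" "B \<in> sets borel"
    by (rule sets_completionE) (simp only: sets_lborel)
  have "AE x in lebesgue. x \<notin> N'"
    using A(3) by (intro AE_not_in) (auto simp: null_sets_completionI)
  then have "(LINT x:A|lebesgue. w x) = (LINT x:B|lebesgue. w x)"
    unfolding set_lebesgue_integral_def using A int that
    by (intro integral_cong_AE borel_measurable_scaleR borel_measurable_indicator) (auto simp: indicator_def)
  then show ?thesis using borel0[OF A(4)] by simp
  qed
  then show ?thesis by (rule density_zero[OF int])
qed

text \<open>This is the fundamental lemma of the calculus of variations. Testing against bumps on
  \<open>{a..b}\<close> and passing to the limit with dominating function \<open>cmod w\<close>
  gives vanishing integrals over all intervals inside \<open>S\<close>.\<close>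

lemma AE_eq_0_if_orthogonal_to_test_functions:
  fixes w :: "real \<Rightarrow> complex"
  assumes S: "open S" and int: "integrable (lebesgue_on S) w"
    and orth: "\<And>\<phi>. \<phi> \<in> test_functions S \<Longrightarrow> (LINT x|lebesgue_on S. w x * \<phi> x) = 0"
  shows "AE x in lebesgue_on S. w x = 0"
proof -
  have Sm[measurable]: "S \<in> sets lebesgue" using S by auto
  have wm: "w \<in> borel_measurable (lebesgue_on S)" using int by auto
  have intv: "(LINT x:{a..b}|lebesgue. w x) = 0" if ab: "{a..b} \<subseteq> S" for a b
  proof -
    let ?h = "\<lambda>n x. w x * complex_of_real (bump a b (1 / Suc n) 1 0 x)"
    have lim: "(\<lambda>n. LINT x|lebesgue_on S. ?h n x) \<longlonglongrightarrow> (LINT x|lebesgue_on S. w x * complex_of_real (indicator {a<..<b} x))"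
    proof (rule integral_dominated_convergence[where w = "\<lambda>x. cmod (w x)"])
      have "continuous_on S (\<lambda>x. complex_of_real (bump a b (1 / Suc n) 1 0 x))" for n
        using bump_has_derivative[of "1 / Suc n" a b 1 0]
        by (intro continuous_intros continuous_at_imp_continuous_on) (auto intro: DERIV_isCont)
      then show "?h n \<in> borel_measurable (lebesgue_on S)" for n
        by (intro borel_measurable_times wm continuous_imp_measurable_on_sets_lebesgue Sm)
      show "AE x in lebesgue_on S. (\<lambda>n. ?h n x) \<longlonglongrightarrow> w x * complex_of_real (indicator {a<..<b} x)"
        by (intro always_eventually allI tendsto_intros bump_tendsto_indicator)
      show "AE x in lebesgue_on S. norm (?h n x) \<le> cmod (w x)" for n
        using bump_1_bounded[of "1 / Suc n" a b]
        by (intro always_eventually allI) (auto simp: norm_mult intro!: mult_left_le)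
      have [measurable]: "{a<..<b} \<in> sets (lebesgue_on S)"
        using ab by (subst sets_restrict_space_iff) auto
      note wm[measurable]
      show "(\<lambda>x. w x * complex_of_real (indicator {a<..<b} x)) \<in> borel_measurable (lebesgue_on S)"
        by measurable
    qed (use int in simp)
    have "(LINT x|lebesgue_on S. ?h n x) = 0" for n
      by (intro orth bump_test_function ab) auto
    then have "(LINT x|lebesgue_on S. w x * complex_of_real (indicator {a<..<b} x)) = 0"
      using lim by (simp add: LIMSEQ_const_iff)
    also have "(LINT x|lebesgue_on S. w x * complex_of_real (indicator {a<..<b} x))
      = (LINT x:{a<..<b}|lebesgue. w x)"
      using ab Sm unfolding set_lebesgue_integral_def
      by (subst integral_restrict_space)
        (auto simp: indicator_def subset_eq intro!: Bochner_Integration.integral_cong)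
    also have "\<dots> = (LINT x:{a..b}|lebesgue. w x)"
    proof -
      \<comment> \<open>Only measurability on \<open>S\<close> is known for \<open>w\<close>, so its
        extension by zero is used to compare the open and the closed interval in
        \<open>lebesgue\<close>.\<close>
      define W where "W = (\<lambda>x. indicator S x *\<^sub>R w x)"
      have W: "(\<lambda>x. indicator I x *\<^sub>R w x) = (\<lambda>x. indicator I x *\<^sub>R W x)" if "I \<subseteq> {a..b}" for I
        using ab that by (auto simp: indicator_def fun_eq_iff W_def)
      have Wm: "W \<in> borel_measurable lebesgue"
        using wm by (simp add: borel_measurable_restrict_space_iff W_def)
      have "(LINT x|lebesgue. indicator {a<..<b} x *\<^sub>R W x) = (LINT x|lebesgue. indicator {a..b} x *\<^sub>R W x)"
      proof (rule integral_cong_AE)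
        have "AE x in lebesgue. x \<notin> {a, b}"
          by (intro AE_not_in) (auto simp: null_sets_completionI)
        then show "AE x in lebesgue. indicator {a<..<b} x *\<^sub>R W x = indicator {a..b} x *\<^sub>R W x"
          by (rule eventually_mono) (auto simp: indicator_def)
      qed (auto intro!: borel_measurable_scaleR borel_measurable_indicator Wm)
      then show ?thesis
        unfolding set_lebesgue_integral_def by (simp add: W greaterThanLessThan_subseteq_atLeastAtMost_iff)
    qed
    finally show ?thesis .
  qed
  \<comment> \<open>An arbitrary interval may leave \<open>S\<close>, where \<open>w\<close> is not
    controlled. Cutting \<open>w\<close> off to \<open>{a..b}\<close> repairs this, since
    intersecting with \<open>{a..b}\<close> yields an interval inside \<open>S\<close>. Countably
    many such intervals then cover \<open>S\<close>, so the exceptional null sets can be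
    united.\<close>
  have "AE x in lebesgue. x \<in> {a..b} \<longrightarrow> w x = 0" if ab: "{a..b} \<subseteq> S" for a b
  proof -
    have "AE x in lebesgue. indicator {a..b} x *\<^sub>R w x = 0"
    proof (rule AE_eq_0_if_intervals)
      have "integrable lebesgue (\<lambda>x. indicator {a..b} x *\<^sub>R indicator S x *\<^sub>R w x)"
        using int by (intro integrable_mult_indicator[where A = "{a..b}"]) (simp_all add: integrable_restrict_space)
      also have "(\<lambda>x. indicator {a..b} x *\<^sub>R indicator S x *\<^sub>R w x) = (\<lambda>x. indicator {a..b} x *\<^sub>R w x)"
        using ab by (auto simp: indicator_def fun_eq_iff)
      finally show "integrable lebesgue (\<lambda>x. indicator {a..b} x *\<^sub>R w x)" .
      show "(LINT x|lebesgue. indicator {a..b} x *\<^sub>R w x) = 0"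
        using intv[OF ab] by (simp add: set_lebesgue_integral_def)
      fix c d
      have "(LINT x:{c..d}|lebesgue. indicator {a..b} x *\<^sub>R w x) = (LINT x:{max a c..min b d}|lebesgue. w x)"
        unfolding set_lebesgue_integral_def
        by (intro Bochner_Integration.integral_cong) (auto simp: indicator_def)
      also have "\<dots> = 0" by (rule intv) (use ab in auto)
      finally show "(LINT x:{c..d}|lebesgue. indicator {a..b} x *\<^sub>R w x) = 0" .
    qed
    then show ?thesis by (auto simp: indicator_def)
  qed
  moreover obtain \<D> where D: "countable \<D>" "\<D> \<subseteq> Pow S" "\<And>X. X \<in> \<D> \<Longrightarrow> \<exists>a b. X = cbox a b" "\<Union>\<D> = S"
    using open_countable_Union_open_cbox[OF S] by metis
  ultimately have "AE x in lebesgue. x \<in> X \<longrightarrow> w x = 0" if "X \<in> \<D>" for X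
    using that by (metis Pow_iff box_real(2) subsetD)
  then have "AE x in lebesgue. \<forall>X\<in>\<D>. x \<in> X \<longrightarrow> w x = 0"
    unfolding AE_ball_countable[OF D(1)] by blast
  then show ?thesis
    using D(4) by (auto simp: AE_restrict_space_iff)
qed

section \<open>Square integrable functions\<close>

lemma L2_space_add:
  assumes "u \<in> L2_space S" "v \<in> L2_space S"
  shows "(\<lambda>x. u x + v x) \<in> L2_space S"
proof -
  have le: "(cmod (a + b))\<^sup>2 \<le> 2 * (cmod a)\<^sup>2 + 2 * (cmod b)\<^sup>2" for a b
  proof -
    have "(cmod (a + b))\<^sup>2 \<le> (cmod a + cmod b)\<^sup>2"
      by (intro power_mono norm_triangle_ineq) auto
    also have "\<dots> \<le> 2 * (cmod a)\<^sup>2 + 2 * (cmod b)\<^sup>2"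
      using sum_squares_bound[of "cmod a" "cmod b"] by (simp add: power2_sum)
    finally show ?thesis .
  qed
  have [measurable]: "u \<in> borel_measurable (lebesgue_on S)" "v \<in> borel_measurable (lebesgue_on S)"
    using assms by (auto simp: L2_space_def)
  have "integrable (lebesgue_on S) (\<lambda>x. (cmod (u x + v x))\<^sup>2)"
  proof (rule Bochner_Integration.integrable_bound)
    show "integrable (lebesgue_on S) (\<lambda>x. 2 * (cmod (u x))\<^sup>2 + 2 * (cmod (v x))\<^sup>2)"
      using assms by (simp add: L2_space_def)
    show "AE x in lebesgue_on S. norm ((cmod (u x + v x))\<^sup>2) \<le> norm (2 * (cmod (u x))\<^sup>2 + 2 * (cmod (v x))\<^sup>2)"
      using le by (intro always_eventually) simp
  qed measurable
  then show ?thesis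
    using assms by (simp add: L2_space_def)
qed

lemma L2_space_cmult: "u \<in> L2_space S \<Longrightarrow> (\<lambda>x. c * u x) \<in> L2_space S"
  unfolding L2_space_def by (auto simp: norm_mult power_mult_distrib)

lemma L2_space_mult_integrable:
  assumes "u \<in> L2_space S" "v \<in> L2_space S"
  shows "integrable (lebesgue_on S) (\<lambda>x. u x * v x)"
proof -
  have le: "cmod a * cmod b \<le> (cmod a)\<^sup>2 + (cmod b)\<^sup>2" for a b
  proof -
    have "0 \<le> cmod a * cmod b" by simp
    then show ?thesis using sum_squares_bound[of "cmod a" "cmod b"] by linarith
  qed
  have [measurable]: "u \<in> borel_measurable (lebesgue_on S)" "v \<in> borel_measurable (lebesgue_on S)"
    using assms by (auto simp: L2_space_def)
  show ?thesis
  proof (rule Bochner_Integration.integrable_bound)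
    show "integrable (lebesgue_on S) (\<lambda>x. (cmod (u x))\<^sup>2 + (cmod (v x))\<^sup>2)"
      using assms by (simp add: L2_space_def)
    show "AE x in lebesgue_on S. norm (u x * v x) \<le> norm ((cmod (u x))\<^sup>2 + (cmod (v x))\<^sup>2)"
      using le by (intro always_eventually) (simp add: norm_mult)
  qed measurable
qed

text \<open>The inequality for nonnegative integrals carries over because \<open>A\<close>,
  \<open>B\<close> and \<open>I\<close> are finite. The pairing is bilinear, without conjugation, as
  in \<open>regular_distribution\<close>.\<close>

lemma L2_Cauchy_Schwarz:
  assumes uv: "u \<in> L2_space S" "v \<in> L2_space S"
  shows "cmod (LINT x|lebesgue_on S. u x * v x) \<le> L2_norm S u * L2_norm S v"
proof -
  let ?M = "lebesgue_on S"
  have [measurable]: "u \<in> borel_measurable ?M" "v \<in> borel_measurable ?M"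
    using uv by (auto simp: L2_space_def)
  define A where "A = (LINT x|?M. (cmod (u x))\<^sup>2)"
  define B where "B = (LINT x|?M. (cmod (v x))\<^sup>2)"
  define I where "I = (LINT x|?M. cmod (u x) * cmod (v x))"
  have nn: "0 \<le> A" "0 \<le> B" "0 \<le> I" by (auto simp: A_def B_def I_def)
  have "(\<integral>\<^sup>+x. ennreal (cmod (u x)) * ennreal (cmod (v x)) \<partial>?M)\<^sup>2
    \<le> (\<integral>\<^sup>+x. ennreal (cmod (u x)) ^ 2 \<partial>?M) * (\<integral>\<^sup>+x. ennreal (cmod (v x)) ^ 2 \<partial>?M)"
    by (rule Cauchy_Schwarz_nn_integral) auto
  moreover have "(\<integral>\<^sup>+x. ennreal (cmod (u x)) * ennreal (cmod (v x)) \<partial>?M) = ennreal I"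
    using integrable_norm[OF L2_space_mult_integrable[OF uv]]
    by (auto simp: I_def ennreal_mult[symmetric] norm_mult intro!: nn_integral_eq_integral)
  moreover have "(\<integral>\<^sup>+x. ennreal (cmod (u x)) ^ 2 \<partial>?M) = ennreal A"
    using uv by (auto simp: A_def L2_space_def ennreal_power intro!: nn_integral_eq_integral)
  moreover have "(\<integral>\<^sup>+x. ennreal (cmod (v x)) ^ 2 \<partial>?M) = ennreal B"
    using uv by (auto simp: B_def L2_space_def ennreal_power intro!: nn_integral_eq_integral)
  ultimately have "I\<^sup>2 \<le> A * B"
    using nn by (simp add: ennreal_power ennreal_mult[symmetric])
  then have "I \<le> sqrt (A * B)" by (rule real_le_rsqrt)
  moreover have "cmod (LINT x|?M. u x * v x) \<le> I"
    using integral_norm_bound[of ?M "\<lambda>x. u x * v x"] by (simp add: I_def norm_mult)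
  ultimately show ?thesis
    by (simp add: L2_norm_def A_def B_def real_sqrt_mult)
qed

section \<open>Test functions: derivatives, bounds and integrability\<close>

lemma vderiv_test_function:
  assumes "\<phi> \<in> test_functions S"
  shows "vderiv \<phi> \<in> test_functions S"
proof -
  from assms obtain K where K: "compact K" "K \<subseteq> S" "\<And>x. x \<notin> K \<Longrightarrow> \<phi> x = 0"
    and d: "\<And>n x. (vderiv ^^ n) \<phi> differentiable (at x)"
    by (auto simp: test_functions_def)
  have "vderiv \<phi> x = 0" if "x \<notin> K" for x
  proof -
    have "((\<lambda>_. 0) has_vector_derivative 0) (at x)" by simp
    then have "(\<phi> has_vector_derivative 0) (at x)"
      by (rule has_vector_derivative_transform_within_open[of _ _ _ "- K"])
        (use K that compact_imp_closed in auto)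
    then show ?thesis by (simp add: vderiv_def vector_derivative_at)
  qed
  moreover have "(vderiv ^^ n) (vderiv \<phi>) differentiable (at x)" for n x
    using d[of "Suc n" x] by (simp add: funpow_swap1)
  ultimately show ?thesis
    using K by (auto simp: test_functions_def)
qed

lemma test_function_has_vderiv:
  assumes "\<phi> \<in> test_functions S"
  shows "(\<phi> has_vector_derivative vderiv \<phi> x) (at x)"
proof -
  have "(vderiv ^^ 0) \<phi> differentiable (at x)"
    using assms unfolding test_functions_def by blast
  then show ?thesis by (simp add: vderiv_def vector_derivative_works)
qed

lemma test_function_continuous:
  assumes "\<phi> \<in> test_functions S"
  shows "continuous_on A \<phi>"
  using test_function_has_vderiv[OF assms]
  by (meson continuous_at_imp_continuous_on has_vector_derivative_continuous)

lemma test_function_bounded: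
  assumes "\<phi> \<in> test_functions S"
  shows "bdd_above (range (\<lambda>x. cmod (\<phi> x)))"
proof -
  from assms obtain K where K: "compact K" "\<And>x. x \<notin> K \<Longrightarrow> \<phi> x = 0"
    by (auto simp: test_functions_def)
  have "bounded (\<phi> ` K)"
    by (intro compact_imp_bounded compact_continuous_image test_function_continuous[OF assms] K)
  then obtain M where "\<forall>x\<in>K. cmod (\<phi> x) \<le> M"
    by (auto simp: bounded_iff)
  then have "cmod (\<phi> x) \<le> \<bar>M\<bar>" for x
    using K(2)[of x] by (cases "x \<in> K") force+
  then show ?thesis by (rule bdd_aboveI2)
qed

lemma test_function_L2:
  assumes S: "S \<in> lmeasurable" and "\<phi> \<in> test_functions S"
  shows "\<phi> \<in> L2_space S"
proof -
  interpret finite_measure "lebesgue_on S" by (rule finite_measure_lebesgue_on[OF S])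
  have [measurable]: "\<phi> \<in> borel_measurable (lebesgue_on S)"
    using S by (intro continuous_imp_measurable_on_sets_lebesgue test_function_continuous[OF assms(2)]) auto
  obtain M where M: "\<And>x. cmod (\<phi> x) \<le> M"
    using test_function_bounded[OF assms(2)] by (auto simp: bdd_above_def)
  then have "integrable (lebesgue_on S) (\<lambda>x. (cmod (\<phi> x))\<^sup>2)"
    by (intro integrable_const_bound[of _ "M\<^sup>2"]) (auto intro!: always_eventually power_mono)
  then show ?thesis by (simp add: L2_space_def)
qed

lemma L2_space_integrable:
  assumes S: "S \<in> lmeasurable" and "u \<in> L2_space S"
  shows "integrable (lebesgue_on S) u"
proof -
  interpret finite_measure "lebesgue_on S" by (rule finite_measure_lebesgue_on[OF S])
  have "(\<lambda>_. 1) \<in> L2_space S" by (simp add: L2_space_def)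
  from L2_space_mult_integrable[OF assms(2) this] show ?thesis by simp
qed

section \<open>Calculus of weak derivatives\<close>

lemma has_weak_derivative_unique:
  assumes S: "open S" "S \<in> lmeasurable" and v: "v \<in> L2_space S" "v' \<in> L2_space S"
    and w: "has_weak_derivative S u v" "has_weak_derivative S u v'"
  shows "AE x in lebesgue_on S. v x = v' x"
proof -
  have "AE x in lebesgue_on S. v x - v' x = 0"
  proof (rule AE_eq_0_if_orthogonal_to_test_functions[OF S(1)])
    show "integrable (lebesgue_on S) (\<lambda>x. v x - v' x)"
      using v S L2_space_integrable by auto
    fix \<phi> assume \<phi>: "\<phi> \<in> test_functions S"
    have "(LINT x|lebesgue_on S. (v x - v' x) * \<phi> x)
        = (LINT x|lebesgue_on S. v x * \<phi> x) - (LINT x|lebesgue_on S. v' x * \<phi> x)"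
      using L2_space_mult_integrable[OF _ test_function_L2[OF S(2) \<phi>]] v
      by (simp add: left_diff_distrib Bochner_Integration.integral_diff)
    also have "\<dots> = 0"
      using w \<phi> unfolding has_weak_derivative_def by (metis add.inverse_inverse cancel_comm_monoid_add_class.diff_cancel)
    finally show "(LINT x|lebesgue_on S. (v x - v' x) * \<phi> x) = 0" .
  qed
  then show ?thesis by simp
qed

lemma has_weak_derivative_add:
  assumes S: "S \<in> lmeasurable"
    and L2: "u \<in> L2_space S" "u' \<in> L2_space S" "v \<in> L2_space S" "v' \<in> L2_space S"
    and w: "has_weak_derivative S u v" "has_weak_derivative S u' v'"
  shows "has_weak_derivative S (\<lambda>x. u x + u' x) (\<lambda>x. v x + v' x)"
  unfolding has_weak_derivative_def
proof
  fix \<phi> assume \<phi>: "\<phi> \<in> test_functions S"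
  note int = L2_space_mult_integrable[OF _ test_function_L2[OF S \<phi>]]
    L2_space_mult_integrable[OF _ test_function_L2[OF S vderiv_test_function[OF \<phi>]]]
  show "(LINT x|lebesgue_on S. (u x + u' x) * vderiv \<phi> x) = - (LINT x|lebesgue_on S. (v x + v' x) * \<phi> x)"
    using w \<phi> L2 by (simp add: has_weak_derivative_def distrib_right int)
qed

lemma has_weak_derivative_cmult:
  "has_weak_derivative S u v \<Longrightarrow> has_weak_derivative S (\<lambda>x. c * u x) (\<lambda>x. c * v x)"
  by (simp add: has_weak_derivative_def mult.assoc)

lemma weak_derivative_L2:
  assumes "u \<in> Sobolev_space S"
  shows "weak_derivative S u \<in> L2_space S" "has_weak_derivative S u (weak_derivative S u)"
proof -
  have "\<exists>v. v \<in> L2_space S \<and> has_weak_derivative S u v"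
    using assms by (auto simp: Sobolev_space_def)
  from someI_ex[OF this] show "weak_derivative S u \<in> L2_space S"
    "has_weak_derivative S u (weak_derivative S u)"
    by (auto simp: weak_derivative_def)
qed

text \<open>\<open>weak_derivative\<close> is an arbitrary choice, so no pointwise formula for it is
  available. This lemma lets any known weak derivative stand in for the chosen one under an
  integral.\<close>

lemma weak_derivative_AE:
  assumes "open S" "S \<in> lmeasurable" "u \<in> L2_space S" "v \<in> L2_space S" "has_weak_derivative S u v"
  shows "AE x in lebesgue_on S. weak_derivative S u x = v x"
proof -
  have "u \<in> Sobolev_space S" using assms by (auto simp: Sobolev_space_def)
  from has_weak_derivative_unique[OF assms(1,2) weak_derivative_L2(1)[OF this] assms(4)
      weak_derivative_L2(2)[OF this] assms(5)]
  show ?thesis .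
qed

subsection \<open>Distributional derivatives of square integrable functions\<close>

text \<open>\<open>G\<close> and \<open>g\<close> may blow up at the ends of the interval. The
  compact support of \<open>\<phi>\<close> confines both integrals to a closed subinterval, where
  everything is continuous and the boundary terms vanish.\<close>

lemma integral_by_parts_test_function:
  assumes G: "\<And>x. x \<in> {\<alpha><..<\<beta>} \<Longrightarrow> (G has_vector_derivative g x) (at x)"
    and g: "continuous_on {\<alpha><..<\<beta>} g" and \<phi>: "\<phi> \<in> test_functions {\<alpha><..<\<beta>}"
  shows "(LINT x|lebesgue_on {\<alpha><..<\<beta>}. G x * vderiv \<phi> x) = - (LINT x|lebesgue_on {\<alpha><..<\<beta>}. g x * \<phi> x)"
proof -
  \<comment> \<open>\<open>test_functions\<close> supplies separate compact sets for
    \<open>\<phi>\<close> and for \<open>vderiv \<phi>\<close>; their union serves both.\<close>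
  obtain K where K: "compact K" "K \<subseteq> {\<alpha><..<\<beta>}" and z: "\<And>x. x \<notin> K \<Longrightarrow> \<phi> x = 0" "\<And>x. x \<notin> K \<Longrightarrow> vderiv \<phi> x = 0"
  proof -
    obtain K where "compact K" "K \<subseteq> {\<alpha><..<\<beta>}" "\<And>x. x \<notin> K \<Longrightarrow> \<phi> x = 0"
      using \<phi> by (auto simp: test_functions_def)
    moreover obtain L where "compact L" "L \<subseteq> {\<alpha><..<\<beta>}" "\<And>x. x \<notin> L \<Longrightarrow> vderiv \<phi> x = 0"
      using vderiv_test_function[OF \<phi>] by (auto simp: test_functions_def)
    ultimately show ?thesis by (intro that[of "K \<union> L"]) auto
  qed
  show ?thesis
  proof (cases "K = {}")
    case True
    then show ?thesis using z by simp
  next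
    case False
    obtain k l where kl: "k \<in> K" "l \<in> K" "\<And>x. x \<in> K \<Longrightarrow> k \<le> x" "\<And>x. x \<in> K \<Longrightarrow> x \<le> l"
      using compact_attains_inf[OF K(1) False] compact_attains_sup[OF K(1) False] by metis
    \<comment> \<open>These midpoints lie strictly between the support and the ends of the interval,
      so \<open>\<phi>\<close> vanishes at \<open>a\<close> and \<open>b\<close> themselves.\<close>
    define a b where "a = (\<alpha> + k) / 2" and "b = (l + \<beta>) / 2"
    have ab: "\<alpha> < a" "a < k" "l < b" "b < \<beta>" "a \<le> b"
    proof -
      have "\<alpha> < k" "l < \<beta>" "k \<le> l" using kl K(2) by auto
      then show "\<alpha> < a" "a < k" "l < b" "b < \<beta>" "a \<le> b"
        by (auto simp: a_def b_def)
    qed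
    have sub: "{a..b} \<subseteq> {\<alpha><..<\<beta>}" using ab by auto
    have out: "\<phi> x = 0" "vderiv \<phi> x = 0" if "x \<notin> {a<..<b}" for x
    proof -
      have "x \<notin> K" using that kl(3,4)[of x] ab by auto
      then show "\<phi> x = 0" "vderiv \<phi> x = 0" using z by auto
    qed
    have cG: "continuous_on {a..b} G"
      using G sub by (meson continuous_at_imp_continuous_on has_vector_derivative_continuous subsetD)
    note c = cG continuous_on_subset[OF g sub] test_function_continuous[OF \<phi>]
      test_function_continuous[OF vderiv_test_function[OF \<phi>]]
    have i1: "integrable (lebesgue_on {a..b}) (\<lambda>x. G x * vderiv \<phi> x)"
      and i2: "integrable (lebesgue_on {a..b}) (\<lambda>x. g x * \<phi> x)"
      by (intro continuous_imp_integrable_real continuous_intros c)+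
    have "((\<lambda>x. G x * vderiv \<phi> x + g x * \<phi> x) has_integral G b * \<phi> b - G a * \<phi> a) {a..b}"
    proof (rule fundamental_theorem_of_calculus)
      fix x assume "x \<in> {a..b}"
      then have "((\<lambda>x. G x * \<phi> x) has_vector_derivative G x * vderiv \<phi> x + g x * \<phi> x) (at x)"
        using sub by (intro has_vector_derivative_mult G test_function_has_vderiv[OF \<phi>]) auto
      then show "((\<lambda>x. G x * \<phi> x) has_vector_derivative G x * vderiv \<phi> x + g x * \<phi> x) (at x within {a..b})"
        by (rule has_vector_derivative_at_within)
    qed (use ab in auto)
    then have "0 = integral {a..b} (\<lambda>x. G x * vderiv \<phi> x + g x * \<phi> x)"
      using out by (simp add: integral_unique)
    also have "\<dots> = (LINT x|lebesgue_on {a..b}. G x * vderiv \<phi> x + g x * \<phi> x)"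
      using i1 i2 by (intro lebesgue_integral_eq_integral[symmetric]) auto
    also have "\<dots> = (LINT x|lebesgue_on {a..b}. G x * vderiv \<phi> x) + (LINT x|lebesgue_on {a..b}. g x * \<phi> x)"
      by (rule Bochner_Integration.integral_add[OF i1 i2])
    also have "(LINT x|lebesgue_on {a..b}. G x * vderiv \<phi> x) = (LINT x|lebesgue_on {\<alpha><..<\<beta>}. G x * vderiv \<phi> x)"
      by (rule lebesgue_on_zero_outside(2)[symmetric, OF sub]) (use out in auto)
    also have "(LINT x|lebesgue_on {a..b}. g x * \<phi> x) = (LINT x|lebesgue_on {\<alpha><..<\<beta>}. g x * \<phi> x)"
      by (rule lebesgue_on_zero_outside(2)[symmetric, OF sub]) (use out in auto)
    finally show ?thesis by (simp add: add_eq_0_iff2)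
  qed
qed

lemma test_function_has_weak_derivative:
  assumes "\<phi> \<in> test_functions {\<alpha><..<\<beta>}"
  shows "has_weak_derivative {\<alpha><..<\<beta>} \<phi> (vderiv \<phi>)"
  unfolding has_weak_derivative_def
  using integral_by_parts_test_function[OF test_function_has_vderiv[OF assms]
      test_function_continuous[OF vderiv_test_function[OF assms]]] by blast

lemma test_function_Sobolev_0:
  assumes \<phi>: "\<phi> \<in> test_functions {\<alpha><..<\<beta>}"
  shows "\<phi> \<in> Sobolev_space_0 {\<alpha><..<\<beta>}"
proof -
  let ?S = "{\<alpha><..<\<beta>}"
  have S: "open ?S" "?S \<in> lmeasurable" by auto
  have "\<phi> \<in> Sobolev_space ?S"
    using test_function_L2[OF S(2)] vderiv_test_function[OF \<phi>] \<phi> test_function_has_weak_derivative[OF \<phi>]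
    by (auto simp: Sobolev_space_def)
  \<comment> \<open>The approximating sequence is constantly \<open>\<phi>\<close>, so the
    difference is the zero function. Its chosen weak derivative is known to vanish only almost
    everywhere.\<close>
  moreover have "Sobolev_norm ?S (\<lambda>x. 0) = 0"
  proof -
    have "(\<lambda>x. 0) \<in> L2_space ?S" "has_weak_derivative ?S (\<lambda>x. 0) (\<lambda>x. 0)"
      by (auto simp: L2_space_def has_weak_derivative_def)
    then have "AE x in lebesgue_on ?S. weak_derivative ?S (\<lambda>x. 0) x = 0"
      by (intro weak_derivative_AE S)
    then have "(LINT x|lebesgue_on ?S. (cmod (weak_derivative ?S (\<lambda>x. 0) x))\<^sup>2) = 0"
      by (intro integral_eq_zero_AE) auto
    then show ?thesis by (simp add: Sobolev_norm_def L2_norm_def)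
  qed
  ultimately show ?thesis
    using \<phi> by (auto simp: Sobolev_space_0_def intro!: exI[of _ "\<lambda>_. \<phi>"])
qed

text \<open>Continuity makes \<open>g\<close> bounded on each compact \<open>K\<close>, so the
  distribution has order 0: the seminorm estimate holds with \<open>N = 0\<close> and a bound of
  \<open>g\<close> on \<open>K\<close> times the measure of \<open>K\<close> as constant.\<close>

lemma regular_distribution_is_distribution:
  assumes S: "open S" and g: "continuous_on S g"
  shows "distribution_on S (regular_distribution S g)"
proof -
  have Sm: "S \<in> sets lebesgue" using S by auto
  have int: "integrable (lebesgue_on S) (\<lambda>x. g x * \<phi> x)"
    and bound: "\<And>M. (\<And>x. x \<in> K \<Longrightarrow> cmod (g x) \<le> M) \<Longrightarrow> 
      cmod (LINT x|lebesgue_on S. g x * \<phi> x) \<le> M * measure lebesgue K * (SUP x. cmod (\<phi> x))"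
    if \<phi>: "\<phi> \<in> test_functions S" and K: "compact K" "K \<subseteq> S" "\<forall>x. x \<notin> K \<longrightarrow> \<phi> x = 0" for K \<phi>
  proof -
    have Km: "K \<in> lmeasurable" using K(1) by (rule lmeasurable_compact)
    then interpret finite_measure "lebesgue_on K" by (rule finite_measure_lebesgue_on)
    have le: "cmod (\<phi> x) \<le> (SUP x. cmod (\<phi> x))" for x
      by (intro cSUP_upper test_function_bounded[OF \<phi>]) auto
    have cont: "continuous_on K (\<lambda>x. g x * \<phi> x)"
      by (intro continuous_intros continuous_on_subset[OF g] K test_function_continuous[OF \<phi>])
    then have meas: "(\<lambda>x. g x * \<phi> x) \<in> borel_measurable (lebesgue_on K)"
      using Km by (intro continuous_imp_measurable_on_sets_lebesgue) auto
    have "bounded ((\<lambda>x. g x * \<phi> x) ` K)"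
      by (intro compact_imp_bounded compact_continuous_image cont K)
    then obtain B where "\<forall>x\<in>K. cmod (g x * \<phi> x) \<le> B"
      by (auto simp: bounded_iff)
    then have intK: "integrable (lebesgue_on K) (\<lambda>x. g x * \<phi> x)"
      using meas by (intro integrable_const_bound[of _ B]) (auto intro!: AE_I2)
    note eq = lebesgue_on_zero_outside[of K S "\<lambda>x. g x * \<phi> x", OF K(2)]
    show "integrable (lebesgue_on S) (\<lambda>x. g x * \<phi> x)"
      using intK eq(1) Km K(3) Sm by auto
    fix M assume M: "\<And>x. x \<in> K \<Longrightarrow> cmod (g x) \<le> M"
    have "cmod (LINT x|lebesgue_on S. g x * \<phi> x) = cmod (LINT x|lebesgue_on K. g x * \<phi> x)"
      using eq(2) Km K(3) Sm by auto
    also have "\<dots> \<le> (LINT x|lebesgue_on K. cmod (g x * \<phi> x))"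
      by (rule integral_norm_bound)
    also have "\<dots> \<le> (LINT x|lebesgue_on K. M * (SUP x. cmod (\<phi> x)))"
    proof (rule integral_mono)
      show "cmod (g x * \<phi> x) \<le> M * (SUP x. cmod (\<phi> x))" if "x \<in> space (lebesgue_on K)" for x
        using M[of x] le[of x] that order_trans[OF norm_ge_zero M[of x]] unfolding norm_mult
        by (intro mult_mono) auto
    qed (use intK in \<open>auto intro: integrable_norm\<close>)
    also have "\<dots> = M * measure lebesgue K * (SUP x. cmod (\<phi> x))"
      using Km by (simp add: measure_restrict_space fmeasurableD)
    finally show "cmod (LINT x|lebesgue_on S. g x * \<phi> x) \<le> M * measure lebesgue K * (SUP x. cmod (\<phi> x))" .
  qed
  have int: "integrable (lebesgue_on S) (\<lambda>x. g x * \<phi> x)" if "\<phi> \<in> test_functions S" for \<phi>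
    using that int[of \<phi>] by (auto simp: test_functions_def)
  have "\<exists>N C. \<forall>\<phi>\<in>test_functions S. (\<forall>x. x \<notin> K \<longrightarrow> \<phi> x = 0) \<longrightarrow>
      cmod (regular_distribution S g \<phi>) \<le> C * (\<Sum>n\<le>N. SUP x. cmod ((vderiv ^^ n) \<phi> x))"
    if K: "compact K" "K \<subseteq> S" for K
  proof -
    have "bounded (g ` K)"
      by (intro compact_imp_bounded compact_continuous_image continuous_on_subset[OF g] K)
    then obtain M where "\<And>x. x \<in> K \<Longrightarrow> cmod (g x) \<le> M"
      by (auto simp: bounded_iff)
    from bound[OF _ K _ this] show ?thesis
      by (intro exI[of _ 0] exI[of _ "M * measure lebesgue K"]) (simp add: regular_distribution_def)
  qed
  then show ?thesis
    unfolding distribution_on_def regular_distribution_def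
    by (auto simp: distrib_left int mult.left_commute)
qed

text \<open>Since \<open>g\<close> may grow at the endpoints, the functional is built from
  \<open>F\<close>, whose pairing with a weak derivative is controlled by the Cauchy-Schwarz
  inequality. Integration by parts is used only to compare it with \<open>g\<close> on test
  functions.\<close>

lemma derivative_of_L2_in_Sobolev_neg_space:
  assumes F: "\<And>x. x \<in> {\<alpha><..<\<beta>} \<Longrightarrow> (F has_vector_derivative g x) (at x)" "F \<in> L2_space {\<alpha><..<\<beta>}"
    and g: "continuous_on {\<alpha><..<\<beta>} g"
  shows "regular_distribution {\<alpha><..<\<beta>} g \<in> Sobolev_neg_space {\<alpha><..<\<beta>}"
proof -
  let ?S = "{\<alpha><..<\<beta>}"
  have S: "open ?S" "?S \<in> lmeasurable" by auto
  define l where "l = (\<lambda>u. - (LINT x|lebesgue_on ?S. F x * weak_derivative ?S u x))"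
  \<comment> \<open>The sum of two chosen weak derivatives is a weak derivative of the sum, but
    possibly not the chosen one. Independence of the choice is what gives linearity.\<close>
  have l_eq: "l u = - (LINT x|lebesgue_on ?S. F x * v x)"
    if "u \<in> L2_space ?S" "v \<in> L2_space ?S" "has_weak_derivative ?S u v" for u v
  proof -
    have wd: "weak_derivative ?S u \<in> L2_space ?S"
      using that weak_derivative_L2 by (auto simp: Sobolev_space_def)
    show ?thesis
      unfolding l_def using weak_derivative_AE[OF S that]
        L2_space_mult_integrable[OF F(2) wd] L2_space_mult_integrable[OF F(2) that(2)]
      by (intro arg_cong[of _ _ uminus] integral_cong_AE) auto
  qed
  have W: "u \<in> L2_space ?S" "weak_derivative ?S u \<in> L2_space ?S"
    "has_weak_derivative ?S u (weak_derivative ?S u)" if "u \<in> Sobolev_space_0 ?S" for u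
    using that weak_derivative_L2[of u ?S] by (auto simp: Sobolev_space_0_def Sobolev_space_def)
  have "l \<in> Sobolev_dual ?S"
    unfolding Sobolev_dual_def mem_Collect_eq
  proof (intro conjI ballI allI exI)
    fix u v assume uv: "u \<in> Sobolev_space_0 ?S" "v \<in> Sobolev_space_0 ?S"
    note U = W[OF uv(1)] and V = W[OF uv(2)]
    have "l (\<lambda>x. u x + v x) = - (LINT x|lebesgue_on ?S. F x * (weak_derivative ?S u x + weak_derivative ?S v x))"
      using U V S by (intro l_eq L2_space_add has_weak_derivative_add) auto
    then show "l (\<lambda>x. u x + v x) = l u + l v"
      using L2_space_mult_integrable[OF F(2)] U V by (simp add: l_def distrib_left)
  next
    fix c u assume u: "u \<in> Sobolev_space_0 ?S"
    have "l (\<lambda>x. c * u x) = - (LINT x|lebesgue_on ?S. F x * (c * weak_derivative ?S u x))"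
      using W[OF u] by (intro l_eq L2_space_cmult has_weak_derivative_cmult) auto
    then show "l (\<lambda>x. c * u x) = c * l u"
      by (simp add: l_def mult.left_commute)
  next
    fix u assume u: "u \<in> Sobolev_space_0 ?S"
    have "cmod (l u) \<le> L2_norm ?S F * L2_norm ?S (weak_derivative ?S u)"
      unfolding l_def norm_minus_cancel by (rule L2_Cauchy_Schwarz[OF F(2) W(2)[OF u]])
    also have "\<dots> \<le> L2_norm ?S F * Sobolev_norm ?S u"
      by (intro mult_left_mono) (auto simp: Sobolev_norm_def L2_norm_def intro!: real_le_rsqrt)
    finally show "cmod (l u) \<le> L2_norm ?S F * Sobolev_norm ?S u" .
  qed
  moreover have "regular_distribution ?S g \<phi> = l \<phi>" if \<phi>: "\<phi> \<in> test_functions ?S" for \<phi>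
    using l_eq[OF _ _ test_function_has_weak_derivative[OF \<phi>]] test_function_L2[OF S(2)] \<phi> vderiv_test_function[OF \<phi>]
      integral_by_parts_test_function[OF F(1) g \<phi>]
    by (simp add: regular_distribution_def)
  ultimately show ?thesis
    using regular_distribution_is_distribution[OF S(1) g] by (auto simp: Sobolev_neg_space_def)
qed

section \<open>Growth and square integrability of the primitive\<close>

text \<open>Up to the factor 4, the difference of powers is an antiderivative of (p - x) powr (-5/4)
  + x powr (-5/4). Its square is at most the sum of the two squares because the mixed term is
  negative, and the exponent -1/2 is integrable at both ends.\<close>

lemma L2_space_if_powr_bound:
  assumes F: "F \<in> borel_measurable (lebesgue_on {0<..<p})"
    and le: "\<And>x. x \<in> {0<..<p} \<Longrightarrow> cmod (F x) \<le> A + B * \<bar>(p - x) powr (-1/4) - x powr (-1/4)\<bar>"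
  shows "F \<in> L2_space {0<..<p}"
proof (cases "0 < p")
  case True
  let ?M = "lebesgue_on {0<..<p}"
  have Mp: "{0<..<p} \<in> lmeasurable" by simp
  interpret finite_measure ?M by (rule finite_measure_lebesgue_on[OF Mp])
  let ?h = "\<lambda>x. 2 * A\<^sup>2 + 2 * B\<^sup>2 * ((p - x) powr (-1/2) + x powr (-1/2))"
  have i0: "((\<lambda>x. x powr (-1/2)) has_integral (p powr (1/2) / (1/2))) {0..p}"
    using has_integral_powr_from_0[of "-1/2" p] True by simp
  \<comment> \<open>The explicit integrals of the powers are gauge integrals. Nonnegativity turns
    them into Lebesgue integrals.\<close>
  have abs_int: "integrable ?M k" if k: "k integrable_on {0..p}" "\<And>x. 0 \<le> k x" for k :: "real \<Rightarrow> real"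
  proof -
    have "k absolutely_integrable_on {0..p}"
      using k by (intro nonnegative_absolutely_integrable_1) auto
    then have "k absolutely_integrable_on {0<..<p}"
      by (rule set_integrable_subset) auto
    then show ?thesis
      by (simp add: set_integrable_def integrable_restrict_space)
  qed
  have i1: "integrable ?M (\<lambda>x. x powr (-1/2))"
    using i0 by (intro abs_int) (auto simp: integrable_on_def)
  have "((\<lambda>x. (p - x) powr (-1/2)) has_integral (p powr (1/2) / (1/2))) {0..p}"
    using has_integral_affinity[of "\<lambda>x. x powr (-1/2)" _ 0 p "-1" p] i0
    by simp
  then have i2: "integrable ?M (\<lambda>x. (p - x) powr (-1/2))"
    by (intro abs_int) (auto simp: integrable_on_def)
  have "integrable ?M (\<lambda>x. (cmod (F x))\<^sup>2)"
  proof (rule Bochner_Integration.integrable_bound)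
    show "integrable ?M ?h" using i1 i2 by auto
    show "(\<lambda>x. (cmod (F x))\<^sup>2) \<in> borel_measurable ?M" using F by measurable
    have "(cmod (F x))\<^sup>2 \<le> ?h x" if x: "x \<in> {0<..<p}" for x
    proof -
      define s t where "s = (p - x) powr (-1/4)" and "t = x powr (-1/4)"
      have nn: "0 \<le> s" "0 \<le> t" by (auto simp: s_def t_def)
      have sq: "s\<^sup>2 = (p - x) powr (-1/2)" "t\<^sup>2 = x powr (-1/2)"
        unfolding s_def t_def using x by (simp_all add: power2_eq_square flip: powr_add)
      have "(cmod (F x))\<^sup>2 \<le> (A + B * \<bar>s - t\<bar>)\<^sup>2"
        using le[OF x] by (intro power_mono) (auto simp: s_def t_def)
      also have "\<dots> \<le> 2 * A\<^sup>2 + 2 * (B * \<bar>s - t\<bar>)\<^sup>2"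
        using sum_squares_bound[of A "B * \<bar>s - t\<bar>"] by (simp add: power2_sum)
      also have "(B * \<bar>s - t\<bar>)\<^sup>2 = B\<^sup>2 * (s - t)\<^sup>2"
        by (simp add: power_mult_distrib)
      also have "2 * A\<^sup>2 + 2 * (B\<^sup>2 * (s - t)\<^sup>2) \<le> 2 * A\<^sup>2 + 2 * (B\<^sup>2 * (s\<^sup>2 + t\<^sup>2))"
        using nn by (intro add_mono mult_left_mono) (auto simp: power2_diff)
      finally show ?thesis unfolding sq by (simp add: algebra_simps)
    qed
    then show "AE x in ?M. norm ((cmod (F x))\<^sup>2) \<le> norm (?h x)"
      by (intro AE_I2) (auto intro: order_trans)
  qed
  then show ?thesis using F by (simp add: L2_space_def)
next
  case False
  then have "{0<..<p} = {}" by auto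
  then show ?thesis using F by (simp add: L2_space_def)
qed

text \<open>The mean value inequality on the segment between \<open>c\<close> and \<open>x\<close>.
  The absolute value accounts for both orders of the two points.\<close>

lemma norm_le_if_deriv_le:
  fixes F :: "real \<Rightarrow> 'b::real_normed_vector"
  assumes F: "\<And>x. x \<in> {\<alpha><..<\<beta>} \<Longrightarrow> (F has_vector_derivative f x) (at x)"
    and G: "\<And>x. x \<in> {\<alpha><..<\<beta>} \<Longrightarrow> (G has_vector_derivative g x) (at x)"
    and le: "\<And>x. x \<in> {\<alpha><..<\<beta>} \<Longrightarrow> norm (f x) \<le> g x"
    and cx: "c \<in> {\<alpha><..<\<beta>}" "x \<in> {\<alpha><..<\<beta>}"
  shows "norm (F x) \<le> norm (F c) + \<bar>G x - G c\<bar>"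
proof -
  have *: "norm (F b - F a) \<le> G b - G a" if "\<alpha> < a" "a \<le> b" "b < \<beta>" for a b
  proof (cases "a = b")
    case False
    have "continuous_on {a..b} F"
      using that by (intro continuous_at_imp_continuous_on ballI has_vector_derivative_continuous[OF F]) auto
    moreover have "continuous_on {a..b} G"
      using that by (intro continuous_at_imp_continuous_on ballI has_vector_derivative_continuous[OF G]) auto
    ultimately show ?thesis
      using that False by (intro differentiable_bound_general[of a b F G f g] F G le) auto
  qed auto
  have "norm (F x - F c) \<le> \<bar>G x - G c\<bar>"
    using *[of x c] *[of c x] cx by (cases "x \<le> c") (auto simp: norm_minus_commute)
  then show ?thesis
    using norm_triangle_sub[of "F x" "F c"] by linarith
qed

theorem corollary1p11:
  fixes D :: "complex set"
  assumes "D = {z. \<bar>Re z - pi / 2\<bar> + \<bar>Im z\<bar> < pi / 2}"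
  shows "(\<lambda>f. regular_distribution {0<..<pi} (\<lambda>x::real. f (complex_of_real x))) ` Bergman_space D
           \<subseteq> Sobolev_neg_space {0<..<pi}"
proof clarify
  fix f assume "f \<in> Bergman_space D"
  then have f: "f holomorphic_on D" and int: "integrable (lebesgue_on D) (\<lambda>z. (cmod (f z))\<^sup>2)"
    by (auto simp: Bergman_space_def)
  let ?S = "{0<..<pi}"
  \<comment> \<open>Writing the square as an intersection of four open half-planes yields openness
    and convexity; convexity provides the global primitive.\<close>
  have D_eq: "D = {z. inner (1 + \<i>) z < pi} \<inter> {z. inner (1 - \<i>) z < pi}
      \<inter> {z. inner (- 1 + \<i>) z < 0} \<inter> {z. inner (- 1 - \<i>) z < 0}"
    unfolding assms by (auto simp: inner_complex_def abs_if split: if_splits)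
  have D: "open D" "convex D"
    unfolding D_eq by (intro open_Int open_halfspace_lt convex_Int convex_halfspace_lt)+
  have realD: "complex_of_real x \<in> D" if "x \<in> ?S" for x
    using that by (auto simp: assms abs_less_iff field_simps)
  obtain P where P: "\<And>z. z \<in> D \<Longrightarrow> (P has_field_derivative f z) (at z within D)"
    using holomorphic_convex_primitive'[OF D(2,1) f] by metis
  define F where "F = (\<lambda>x. P (complex_of_real x))"
  have F: "(F has_vector_derivative f (complex_of_real x)) (at x)" if "x \<in> ?S" for x
    unfolding F_def using P[OF realD[OF that]] at_within_open[OF realD[OF that] D(1)]
    by (intro has_vector_derivative_real_field) simp
  have cont: "continuous_on ?S (\<lambda>x. f (complex_of_real x))"
    by (rule continuous_on_compose2[OF holomorphic_on_imp_continuous_on[OF f]])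
      (use realD in \<open>auto intro!: continuous_intros\<close>)
  define N where "N = (LINT z|lebesgue_on D. (cmod (f z))\<^sup>2)"
  \<comment> \<open>The factor 5 comes from the choice of \<open>r\<close> below, (16 + N) / (2 pi)
    from the pointwise bound, and \<open>pi powr (1 / 4)\<close> from 1 / y = y powr (1/4) * y powr
    (-5/4) with y < pi.\<close>
  define C where "C = 5 * (16 + N) / (2 * pi) * pi powr (1 / 4)"
  have N: "0 \<le> N" by (simp add: N_def)
  \<comment> \<open>Weakening \<open>1 / x\<close> to \<open>x powr (- 5 / 4)\<close> makes the primitive a power, whose square \<open>x powr (- 1 / 2)\<close> has
    an explicit integral.\<close>
  have f_le: "cmod (f (complex_of_real x)) \<le> C * ((pi - x) powr (- 5 / 4) + x powr (- 5 / 4))"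
    if x: "x \<in> ?S" for x
  proof -
    \<comment> \<open>A point of the square of half-side 2 r satisfies \<bar>Re z - pi / 2\<bar> +
      \<bar>Im z\<bar> \<le> (pi / 2 - 5 r) + 2 r + 2 r < pi / 2. Any divisor above 4 would keep the
      closed square inside \<open>D\<close>.\<close>
    define r where "r = min x (pi - x) / 5"
    have r: "0 < r" using x by (simp add: r_def)
    have "cbox (Complex (x - 2 * r) (0 - 2 * r)) (Complex (x + 2 * r) (0 + 2 * r)) \<subseteq> D"
    proof
      fix z assume "z \<in> cbox (Complex (x - 2 * r) (0 - 2 * r)) (Complex (x + 2 * r) (0 + 2 * r))"
      then have "\<bar>Re z - x\<bar> \<le> 2 * r" "\<bar>Im z\<bar> \<le> 2 * r"
        by (auto simp: in_cbox_complex_iff)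
      moreover have "\<bar>x - pi / 2\<bar> = pi / 2 - 5 * r"
        by (auto simp: r_def min_def abs_if)
      ultimately show "z \<in> D"
        using r by (simp add: assms abs_if split: if_splits)
    qed
    note bound = Bergman_pointwise_bound[OF D(1) this f r int]
    have "1 / r \<le> 5 / (pi - x) + 5 / x"
      using x by (auto simp: r_def min_def)
    also have "5 / (pi - x) + 5 / x \<le> 5 * (pi powr (1/4) * (pi - x) powr (-5/4)) + 5 * (pi powr (1/4) * x powr (-5/4))"
    proof -
      have "1 / y \<le> pi powr (1/4) * y powr (-5/4)" if "y \<in> ?S" for y
      proof -
        have "1 / y = y powr (1/4 + -5/4)"
          using that by (simp add: powr_minus_divide)
        also have "\<dots> = y powr (1/4) * y powr (-5/4)"
          by (rule powr_add)
        also have "\<dots> \<le> pi powr (1/4) * y powr (-5/4)"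
          using that by (intro mult_right_mono powr_mono2) auto
        finally show ?thesis .
      qed
      from this[of x] this[of "pi - x"] show ?thesis using x by auto
    qed
    finally have "(16 + N) / (2 * pi) * (1 / r) \<le> (16 + N) / (2 * pi)
        * (5 * (pi powr (1/4) * (pi - x) powr (-5/4)) + 5 * (pi powr (1/4) * x powr (-5/4)))"
      using N by (intro mult_left_mono) auto
    then show ?thesis
      using bound by (simp add: C_def N_def Complex_eq add_divide_distrib algebra_simps)
  qed
  \<comment> \<open>An antiderivative of the bound in \<open>f_le\<close>. By symmetry it vanishes
    at \<open>pi / 2\<close>, which is therefore the base point for the comparison with
    \<open>F\<close>.\<close>
  define G where "G = (\<lambda>x. 4 * C * ((pi - x) powr (- 1 / 4) - x powr (- 1 / 4)))"
  have G: "(G has_vector_derivative C * ((pi - x) powr (- 5 / 4) + x powr (- 5 / 4))) (at x)"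
    if "x \<in> ?S" for x
    unfolding G_def has_real_derivative_iff_has_vector_derivative[symmetric] using that
    by (auto intro!: derivative_eq_intros simp: algebra_simps)
  have F_le: "cmod (F x) \<le> cmod (F (pi / 2)) + 4 * C * \<bar>(pi - x) powr (- 1 / 4) - x powr (- 1 / 4)\<bar>"
    if x: "x \<in> ?S" for x
  proof -
    have "cmod (F x) \<le> cmod (F (pi / 2)) + \<bar>G x - G (pi / 2)\<bar>"
      using x by (intro norm_le_if_deriv_le[OF F G f_le]) auto
    moreover have "0 \<le> C" using N by (simp add: C_def)
    ultimately show ?thesis by (simp add: G_def abs_mult)
  qed
  have "F \<in> L2_space ?S"
  proof (rule L2_space_if_powr_bound[OF _ F_le])
    have "continuous_on ?S F"
      by (intro continuous_at_imp_continuous_on ballI has_vector_derivative_continuous[OF F])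
    then show "F \<in> borel_measurable (lebesgue_on ?S)"
      by (intro continuous_imp_measurable_on_sets_lebesgue) auto
  qed auto
  from derivative_of_L2_in_Sobolev_neg_space[OF F this cont]
  show "regular_distribution ?S (\<lambda>x. f (complex_of_real x)) \<in> Sobolev_neg_space ?S" .
qed

end
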